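(* The deterministic subcategory of $\mathsf{BKer}$ is precisely $\mathsf{BAlg}^{\mathsf{op}}\hookrightarrow\mathsf{BKer}$; that is, a morphism of $\mathsf{BKer}$ is deterministic if and only if it is in the image of this embedding.
   Context: $\mathsf{EAlg}$ is the category of effect algebras: partial commutative monoids $(E,\oplus,0)$ with an element $1$ such that every $a$ has a unique $a^\perp$ with $a\oplus a^\perp=1$, and such that $a\oplus1$ defined implies $a=0$; morphisms preserve $1$ and all defined sums. Every Boolean algebra is an effect algebra, with $a\oplus b$ defined iff $a\wedge b=0$, and then $a\oplus b=a\vee b$; the category $\mathsf{BAlg}$ of Boolean algebras is a full subcategory of $\mathsf{EAlg}$. $\otimes$ is the tensor product of effect algebras (universal for bimorphisms, i.e. maps additive in each variable and sending $(1,1)$ to $1$), with unit $\mathbb{2}=\{\bot,\top\}$, the initial object of $\mathsf{EAlg}$; for Boolean algebras $A,B$, $A\otimes B$ is their coproduct $A+_{\mathsf{BAlg}}B$ in $\mathsf{BAlg}$. $\mathbb{I}$ is the effect algebra $[0,1]$ with $a\oplus b$ defined iff $a+b\le1$, and then equal to $a+b$. It is a monoid for $\otimes$, with multiplication $\mathbb{I}\otimes\mathbb{I}\to\mathbb{I}$ induced by multiplication of reals and unit the unique map $\mathbb{2}\to\mathbb{I}$, so $\mathbb{I}\otimes(-)$ is a monad on $\mathsf{EAlg}$. $\mathsf{BKer}$ is the opposite of the Kleisli category of the monad $\mathbb{I}\otimes(-)$ on $\mathsf{EAlg}$, restricted to the objects of $\mathsf{BAlg}$: objects are Boolean algebras,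 and morphisms $A\to B$ are maps $B\to\mathbb{I}\otimes A$ in $\mathsf{EAlg}$. The tensor on objects is $A\otimes B$; morphisms given by $f:B\to\mathbb{I}\otimes A$ and $f':B'\to\mathbb{I}\otimes A'$ are tensored as $B\otimes B'\to\mathbb{I}\otimes A\otimes\mathbb{I}\otimes A'\cong\mathbb{I}\otimes\mathbb{I}\otimes A\otimes A'\to\mathbb{I}\otimes A\otimes A'$. The monoidal unit is $\mathbb{2}$. The discard map of $A$ is the unique map $\mathbb{2}\to\mathbb{I}\otimes A$, and the copy map $A\to A\otimes A$ of $\mathsf{BKer}$ is the map $A\otimes A\cong A+_{\mathsf{BAlg}}A\to A\cong\mathbb{2}\otimes A\to\mathbb{I}\otimes A$ given by the codiagonal followed by the unit of $\mathbb{I}$. The embedding $\mathsf{BAlg}^{\mathsf{op}}\hookrightarrow\mathsf{BKer}$ is the identity on objects and sends a Boolean homomorphism $B\to A$ to the composite $B\to A\cong\mathbb{2}\otimes A\to\mathbb{I}\otimes A$. A morphism $f:A\to B$ is deterministic if $\mathsf{copy}_B\circ f=(f\otimes f)\circ\mathsf{copy}_A$. *)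

theory Defs
  imports Complex_Main "HOL-Library.Multiset" "HOL-Library.FuncSet"
begin

section \<open>Effect algebras\<close>

record 'a ealg =
  ecarrier :: "'a set"
  osum :: "'a \<Rightarrow> 'a \<Rightarrow> 'a option"
  ezero :: 'a
  eone :: 'a

text \<open>\<open>osum E a b = None\<close> means that the sum of \<open>a\<close> and \<open>b\<close> is undefined. In the presence of
  commutativity, the partial associativity law amounts to the Kleene equation \<open>osum_assoc\<close>.\<close>

locale effect_algebra =
  fixes E :: "'a ealg"
  assumes zero_closed: "ezero E \<in> ecarrier E"
    and one_closed: "eone E \<in> ecarrier E"
    and osum_closed: "\<lbrakk>a \<in> ecarrier E; b \<in> ecarrier E; osum E a b = Some c\<rbrakk> \<Longrightarrow> c \<in> ecarrier E"
    and osum_commute: "\<lbrakk>a \<in> ecarrier E; b \<in> ecarrier E\<rbrakk> \<Longrightarrow> osum E a b = osum E b a"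
    and osum_assoc: "\<lbrakk>a \<in> ecarrier E; b \<in> ecarrier E; c \<in> ecarrier E\<rbrakk> \<Longrightarrow>
      Option.bind (osum E a b) (\<lambda>s. osum E s c) = Option.bind (osum E b c) (\<lambda>t. osum E a t)"
    and osum_zero: "a \<in> ecarrier E \<Longrightarrow> osum E (ezero E) a = Some a"
    and orthosupplement: "a \<in> ecarrier E \<Longrightarrow> \<exists>!b. b \<in> ecarrier E \<and> osum E a b = Some (eone E)"
    and zero_one_law: "\<lbrakk>a \<in> ecarrier E; osum E a (eone E) \<noteq> None\<rbrakk> \<Longrightarrow> a = ezero E"

text \<open>Maps are extensional (arbitrary but fixed outside the carrier), so that equality of morphisms
  is equality of functions.\<close>

definition additive_maps :: "'a ealg \<Rightarrow> 'b ealg \<Rightarrow> ('a \<Rightarrow> 'b) set" where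
  "additive_maps E F = {f \<in> ecarrier E \<rightarrow>\<^sub>E ecarrier F.
     \<forall>a\<in>ecarrier E. \<forall>b\<in>ecarrier E. \<forall>c. osum E a b = Some c \<longrightarrow> osum F (f a) (f b) = Some (f c)}"

definition ealg_hom :: "'a ealg \<Rightarrow> 'b ealg \<Rightarrow> ('a \<Rightarrow> 'b) set" where
  "ealg_hom E F = {f \<in> additive_maps E F. f (eone E) = eone F}"

definition biadditive :: "'a ealg \<Rightarrow> 'b ealg \<Rightarrow> 'c ealg \<Rightarrow> ('a \<Rightarrow> 'b \<Rightarrow> 'c) \<Rightarrow> bool" where
  "biadditive E F G h \<longleftrightarrow>
     (\<forall>a\<in>ecarrier E. \<forall>b\<in>ecarrier F. h a b \<in> ecarrier G) \<and>
     (\<forall>a\<in>ecarrier E. \<forall>a'\<in>ecarrier E. \<forall>s. \<forall>b\<in>ecarrier F. osum E a a' = Some s \<longrightarrow>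
        osum G (h a b) (h a' b) = Some (h s b)) \<and>
     (\<forall>a\<in>ecarrier E. \<forall>b\<in>ecarrier F. \<forall>b'\<in>ecarrier F. \<forall>s. osum F b b' = Some s \<longrightarrow>
        osum G (h a b) (h a b') = Some (h a s))"

definition bimorphism :: "'a ealg \<Rightarrow> 'b ealg \<Rightarrow> 'c ealg \<Rightarrow> ('a \<Rightarrow> 'b \<Rightarrow> 'c) \<Rightarrow> bool" where
  "bimorphism E F G h \<longleftrightarrow> biadditive E F G h \<and> h (eone E) (eone F) = eone G"


section \<open>The tensor product\<close>

text \<open>A concrete construction: elements are classes of formal sums of pairs that can be completed
  to the formal sum \<open>{#(1, 1)#}\<close>. Formal sums are identified by the least congruence that is
  biadditive and forces the quotient to satisfy the axioms of an effect algebra (rules \<open>cancel\<close>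
  and \<open>pos\<close>). That this is the tensor product is proved below: \<open>effect_algebra_tensor\<close>,
  \<open>bimorphism_pure\<close> and \<open>tensor_universal\<close>.\<close>

definition formal_sums :: "'a ealg \<Rightarrow> 'b ealg \<Rightarrow> ('a \<times> 'b) multiset set" where
  "formal_sums E F = {x. set_mset x \<subseteq> ecarrier E \<times> ecarrier F}"

definition formal_one :: "'a ealg \<Rightarrow> 'b ealg \<Rightarrow> ('a \<times> 'b) multiset" where
  "formal_one E F = {#(eone E, eone F)#}"

inductive trel :: "'a ealg \<Rightarrow> 'b ealg \<Rightarrow> ('a \<times> 'b) multiset \<Rightarrow> ('a \<times> 'b) multiset \<Rightarrow> bool"
  for E :: "'a ealg" and F :: "'b ealg" where
  refl: "x \<in> formal_sums E F \<Longrightarrow> trel E F x x"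
| sym: "trel E F x y \<Longrightarrow> trel E F y x"
| trans: "trel E F x y \<Longrightarrow> trel E F y z \<Longrightarrow> trel E F x z"
| add: "trel E F x y \<Longrightarrow> z \<in> formal_sums E F \<Longrightarrow> trel E F (x + z) (y + z)"
| add_left: "\<lbrakk>a \<in> ecarrier E; a' \<in> ecarrier E; osum E a a' = Some s; s \<in> ecarrier E; b \<in> ecarrier F\<rbrakk>
    \<Longrightarrow> trel E F {#(a, b), (a', b)#} {#(s, b)#}"
| add_right: "\<lbrakk>a \<in> ecarrier E; b \<in> ecarrier F; b' \<in> ecarrier F; osum F b b' = Some s; s \<in> ecarrier F\<rbrakk>
    \<Longrightarrow> trel E F {#(a, b), (a, b')#} {#(a, s)#}"
| cancel: "\<lbrakk>x \<in> formal_sums E F; y \<in> formal_sums E F; z \<in> formal_sums E F;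
    trel E F (x + y) (formal_one E F); trel E F (x + z) (formal_one E F)\<rbrakk> \<Longrightarrow> trel E F y z"
| pos: "\<lbrakk>x \<in> formal_sums E F; y \<in> formal_sums E F;
    trel E F (x + formal_one E F + y) (formal_one E F)\<rbrakk> \<Longrightarrow> trel E F x {#}"

definition tclass :: "'a ealg \<Rightarrow> 'b ealg \<Rightarrow> ('a \<times> 'b) multiset \<Rightarrow> ('a \<times> 'b) multiset set" where
  "tclass E F x = {y. trel E F x y}"

definition summable_formal :: "'a ealg \<Rightarrow> 'b ealg \<Rightarrow> ('a \<times> 'b) multiset set" where
  "summable_formal E F = {x \<in> formal_sums E F.
     \<exists>y \<in> formal_sums E F. trel E F (x + y) (formal_one E F)}"

definition tensor :: "'a ealg \<Rightarrow> 'b ealg \<Rightarrow> ('a \<times> 'b) multiset set ealg" where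
  "tensor E F = \<lparr>
     ecarrier = tclass E F ` summable_formal E F,
     osum = (\<lambda>P Q. let S = (\<Union>x\<in>P. \<Union>y\<in>Q. tclass E F (x + y))
              in if S \<in> tclass E F ` summable_formal E F then Some S else None),
     ezero = tclass E F {#},
     eone = tclass E F (formal_one E F)\<rparr>"

definition pure :: "'a ealg \<Rightarrow> 'b ealg \<Rightarrow> 'a \<Rightarrow> 'b \<Rightarrow> ('a \<times> 'b) multiset set" where
  "pure E F a b = tclass E F {#(a, b)#}"

context effect_algebra
begin

lemma osum_zero_right: "a \<in> ecarrier E \<Longrightarrow> osum E a (ezero E) = Some a"
  using osum_zero osum_commute zero_closed by metis

lemma osum_cancel:
  assumes "a \<in> ecarrier E" "b \<in> ecarrier E" "b' \<in> ecarrier E"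
    and b: "osum E a b = Some c" and b': "osum E a b' = Some c"
  shows "b = b'"
proof -
  have c: "c \<in> ecarrier E" using assms osum_closed by blast
  obtain d where d: "d \<in> ecarrier E" "osum E c d = Some (eone E)"
    using orthosupplement[OF c] by blast
  have dc: "osum E d c = Some (eone E)" using d c osum_commute by metis
  have 1: "Option.bind (osum E d a) (\<lambda>s. osum E s b) = Some (eone E)"
    using osum_assoc[of d a b] assms d dc by simp
  have 2: "Option.bind (osum E d a) (\<lambda>s. osum E s b') = Some (eone E)"
    using osum_assoc[of d a b'] assms d dc by simp
  obtain s where s: "osum E d a = Some s" using 1 by (cases "osum E d a") auto
  have "s \<in> ecarrier E" using s d assms osum_closed by blast
  then show ?thesis using orthosupplement[of s] 1 2 s assms by auto
qed

lemma osum_self_zero: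
  assumes "a \<in> ecarrier E" "b \<in> ecarrier E" "osum E a b = Some a" shows "b = ezero E"
  using osum_cancel[of a b "ezero E" a] assms osum_zero_right zero_closed by auto

definition padd :: "'a \<Rightarrow> 'a option \<Rightarrow> 'a option" where
  "padd a r = (case r of None \<Rightarrow> None
     | Some v \<Rightarrow> if a \<in> ecarrier E \<and> v \<in> ecarrier E then osum E a v else None)"

definition msum :: "('i \<Rightarrow> 'a) \<Rightarrow> 'i multiset \<Rightarrow> 'a option" where
  "msum h x = fold_mset (\<lambda>p. padd (h p)) (Some (ezero E)) x"

lemma padd_padd:
  assumes "a \<in> ecarrier E" "b \<in> ecarrier E" "v \<in> ecarrier E"
  shows "padd a (padd b (Some v)) = Option.bind (osum E a b) (\<lambda>s. osum E s v)"
proof -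
  have "padd a (padd b (Some v)) = Option.bind (osum E b v) (\<lambda>t. osum E a t)"
    using assms osum_closed[of b v] by (cases "osum E b v") (auto simp: padd_def)
  then show ?thesis using osum_assoc[OF assms] by simp
qed

lemma padd_commute: "padd a (padd b r) = padd b (padd a r)"
proof (cases "a \<in> ecarrier E \<and> b \<in> ecarrier E \<and> (\<exists>v\<in>ecarrier E. r = Some v)")
  case True
  then obtain v where v: "a \<in> ecarrier E" "b \<in> ecarrier E" "v \<in> ecarrier E" "r = Some v" by blast
  show ?thesis using padd_padd[OF v(1-3)] padd_padd[OF v(2,1,3)] osum_commute[OF v(1,2)] v(4)
    by simp
next
  case False
  then show ?thesis by (auto simp: padd_def split: option.splits)
qed

lemma msum_empty [simp]: "msum h {#} = Some (ezero E)"
  by (simp add: msum_def)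

lemma msum_add_mset [simp]: "msum h (add_mset p x) = padd (h p) (msum h x)"
proof -
  interpret comp_fun_commute "\<lambda>p. padd (h p)"
    by standard (auto simp: padd_commute fun_eq_iff)
  show ?thesis by (simp add: msum_def)
qed

lemma padd_closed: "padd a r = Some w \<Longrightarrow> w \<in> ecarrier E"
  using osum_closed[of a "the r" w] by (auto simp: padd_def split: option.splits if_splits)

lemma msum_closed: "msum h x = Some v \<Longrightarrow> v \<in> ecarrier E"
proof (induction x arbitrary: v)
  case empty then show ?case using zero_closed by auto
next
  case (add p x)
  then have "padd (h p) (msum h x) = Some v" by simp
  then show ?case using padd_closed by blast
qed

lemma msum_union:
  "msum h (x + y) = Option.bind (msum h x) (\<lambda>v. Option.bind (msum h y) (\<lambda>w. osum E v w))"
proof (induction x)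
  case empty
  show ?case using msum_closed[of h y] osum_zero by (cases "msum h y") auto
next
  case (add p x)
  show ?case
  proof (cases "msum h x")
    case None
    then show ?thesis using add by (simp add: padd_def)
  next
    case (Some v)
    note v = Some
    show ?thesis
    proof (cases "msum h y")
      case None
      then show ?thesis using add v by (cases "padd (h p) (Some v)") (auto simp: padd_def)
    next
      case (Some w)
      have c: "v \<in> ecarrier E" "w \<in> ecarrier E" using v Some msum_closed by blast+
      show ?thesis
      proof (cases "h p \<in> ecarrier E")
        case True
        have "padd (h p) (osum E v w) = Option.bind (osum E v w) (osum E (h p))"
          using True c osum_closed[of v w] by (cases "osum E v w") (auto simp: padd_def)
        then show ?thesis using add v Some c True osum_assoc[of "h p" v w] by (simp add: padd_def)
      next
        case False
        then show ?thesis using add v Some by (simp add: padd_def split: option.splits)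
      qed
    qed
  qed
qed

lemma msum_single: "h p \<in> ecarrier E \<Longrightarrow> msum h {#p#} = Some (h p)"
  by (simp add: padd_def zero_closed osum_zero_right)

lemma msum_pair:
  "h p \<in> ecarrier E \<Longrightarrow> h q \<in> ecarrier E \<Longrightarrow> msum h {#p, q#} = osum E (h p) (h q)"
  by (simp add: padd_def zero_closed osum_zero_right)

end

lemma formal_sums_union [simp]:
  "x + y \<in> formal_sums E F \<longleftrightarrow> x \<in> formal_sums E F \<and> y \<in> formal_sums E F"
  by (auto simp: formal_sums_def)

lemma formal_sums_add_mset [simp]:
  "add_mset (a, b) x \<in> formal_sums E F \<longleftrightarrow>
     a \<in> ecarrier E \<and> b \<in> ecarrier F \<and> x \<in> formal_sums E F"
  by (auto simp: formal_sums_def)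

lemma formal_sums_empty [simp]: "{#} \<in> formal_sums E F"
  by (auto simp: formal_sums_def)

locale ealg_pair = E: effect_algebra E + F: effect_algebra F
  for E :: "'a ealg" and F :: "'b ealg"
begin

lemma formal_one_closed [simp]: "formal_one E F \<in> formal_sums E F"
  by (simp add: formal_one_def E.one_closed F.one_closed)

lemma trel_closed: "trel E F x y \<Longrightarrow> x \<in> formal_sums E F \<and> y \<in> formal_sums E F"
  by (induction rule: trel.induct) simp_all

lemma tclass_eq:
  assumes "x \<in> formal_sums E F" "y \<in> formal_sums E F"
  shows "tclass E F x = tclass E F y \<longleftrightarrow> trel E F x y"
  unfolding tclass_def
  using assms by (auto intro: trel.refl trel.sym trel.trans)

lemma tclass_eqI: "trel E F x y \<Longrightarrow> tclass E F x = tclass E F y"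
  using tclass_eq trel_closed by blast

lemma trel_add2:
  assumes "trel E F x x'" "trel E F y y'" shows "trel E F (x + y) (x' + y')"
  by (metis assms trel.add trel.trans trel_closed union_commute)

lemma summable_formal_trel:
  assumes "trel E F x y" shows "x \<in> summable_formal E F \<longleftrightarrow> y \<in> summable_formal E F"
proof -
  have "y \<in> summable_formal E F" if "trel E F x y" "x \<in> summable_formal E F" for x y
  proof -
    obtain z where z: "z \<in> formal_sums E F" "trel E F (x + z) (formal_one E F)"
      using \<open>x \<in> _\<close> by (auto simp: summable_formal_def)
    have "trel E F (y + z) (x + z)" using that z by (simp add: trel.add trel.sym)
    then have "trel E F (y + z) (formal_one E F)" using z(2) by (rule trel.trans)
    then show ?thesis using z(1) trel_closed[OF that(1)] unfolding summable_formal_def by blast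
  qed
  then show ?thesis using assms trel.sym by blast
qed

lemma summable_formal_left:
  "x + y \<in> summable_formal E F \<Longrightarrow> x \<in> summable_formal E F"
  unfolding summable_formal_def by (auto simp: add.assoc)

lemma summable_formal_right:
  "x + y \<in> summable_formal E F \<Longrightarrow> y \<in> summable_formal E F"
  using summable_formal_left[of y x] by (simp add: add.commute)

lemma summable_formal_sums: "x \<in> summable_formal E F \<Longrightarrow> x \<in> formal_sums E F"
  by (simp add: summable_formal_def)

lemma formal_one_summable [simp]: "formal_one E F \<in> summable_formal E F"
  by (auto simp: summable_formal_def intro!: bexI[of _ "{#}"] trel.refl)

lemma empty_summable [simp]: "{#} \<in> summable_formal E F"
  using summable_formal_left[of "{#}" "formal_one E F"] by simp

lemma tclass_in_tensor:
  assumes "x \<in> formal_sums E F"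
  shows "tclass E F x \<in> ecarrier (tensor E F) \<longleftrightarrow> x \<in> summable_formal E F"
proof
  assume "tclass E F x \<in> ecarrier (tensor E F)"
  then obtain y where "y \<in> summable_formal E F" "tclass E F x = tclass E F y"
    by (auto simp: tensor_def)
  then show "x \<in> summable_formal E F"
    using tclass_eq summable_formal_trel summable_formal_sums assms by blast
qed (auto simp: tensor_def)

lemma tensor_cases:
  assumes "P \<in> ecarrier (tensor E F)"
  obtains x where "x \<in> summable_formal E F" "P = tclass E F x"
  using assms by (auto simp: tensor_def)

lemma tensor_zero: "ezero (tensor E F) = tclass E F {#}"
  and tensor_one: "eone (tensor E F) = tclass E F (formal_one E F)"
  by (simp_all add: tensor_def)

lemma tensor_osum:
  assumes "x \<in> formal_sums E F" "y \<in> formal_sums E F"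
  shows "osum (tensor E F) (tclass E F x) (tclass E F y) =
    (if x + y \<in> summable_formal E F then Some (tclass E F (x + y)) else None)"
proof -
  have "(\<Union>x'\<in>tclass E F x. \<Union>y'\<in>tclass E F y. tclass E F (x' + y')) = tclass E F (x + y)"
    (is "?L = _")
  proof -
    have "tclass E F (x' + y') = tclass E F (x + y)"
      if "x' \<in> tclass E F x" "y' \<in> tclass E F y" for x' y'
    proof -
      have "trel E F x x'" "trel E F y y'" using that by (simp_all add: tclass_def)
      then show ?thesis using tclass_eqI[OF trel_add2] by metis
    qed
    moreover have "x \<in> tclass E F x" "y \<in> tclass E F y"
      using assms by (auto simp: tclass_def trel.refl)
    ultimately show ?thesis by blast
  qed
  then show ?thesis
    using tclass_in_tensor[of "x + y"] assms by (simp add: tensor_def Let_def)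
qed

theorem effect_algebra_tensor: "effect_algebra (tensor E F)"
proof
  show "ezero (tensor E F) \<in> ecarrier (tensor E F)" "eone (tensor E F) \<in> ecarrier (tensor E F)"
    by (simp_all add: tensor_zero tensor_one tclass_in_tensor)
next
  fix P Q R assume "P \<in> ecarrier (tensor E F)" "Q \<in> ecarrier (tensor E F)"
    "osum (tensor E F) P Q = Some R"
  then show "R \<in> ecarrier (tensor E F)"
    by (auto elim!: tensor_cases simp: tensor_osum summable_formal_sums tclass_in_tensor
        split: if_splits)
next
  fix P Q assume "P \<in> ecarrier (tensor E F)" "Q \<in> ecarrier (tensor E F)"
  then show "osum (tensor E F) P Q = osum (tensor E F) Q P"
    by (auto elim!: tensor_cases simp: tensor_osum summable_formal_sums add.commute)
next
  fix P Q R assume "P \<in> ecarrier (tensor E F)" "Q \<in> ecarrier (tensor E F)"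
    "R \<in> ecarrier (tensor E F)"
  then obtain x y z where xyz: "P = tclass E F x" "Q = tclass E F y" "R = tclass E F z"
      "x \<in> formal_sums E F" "y \<in> formal_sums E F" "z \<in> formal_sums E F"
    by (metis tensor_cases summable_formal_sums)
  show "Option.bind (osum (tensor E F) P Q) (\<lambda>s. osum (tensor E F) s R) =
        Option.bind (osum (tensor E F) Q R) (\<lambda>t. osum (tensor E F) P t)"
    using xyz summable_formal_left[of "x + y" z] summable_formal_right[of x "y + z"]
    by (auto simp: tensor_osum add.assoc)
next
  fix P assume "P \<in> ecarrier (tensor E F)"
  then show "osum (tensor E F) (ezero (tensor E F)) P = Some P"
    by (auto elim!: tensor_cases simp: tensor_osum tensor_zero summable_formal_sums)
next
  fix P assume "P \<in> ecarrier (tensor E F)"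
  then obtain x where x: "x \<in> summable_formal E F" "P = tclass E F x" by (rule tensor_cases)
  then obtain y where y: "y \<in> formal_sums E F" "trel E F (x + y) (formal_one E F)"
    by (auto simp: summable_formal_def)
  have xs: "x \<in> formal_sums E F" using x summable_formal_sums by blast
  have xy: "x + y \<in> summable_formal E F"
    using y summable_formal_trel formal_one_summable by blast
  show "\<exists>!Q. Q \<in> ecarrier (tensor E F) \<and> osum (tensor E F) P Q = Some (eone (tensor E F))"
  proof (rule ex1I[of _ "tclass E F y"])
    show "tclass E F y \<in> ecarrier (tensor E F) \<and>
      osum (tensor E F) P (tclass E F y) = Some (eone (tensor E F))"
      using x xs y xy summable_formal_right[OF xy]
      by (simp add: tclass_in_tensor tensor_osum tensor_one tclass_eq)
  next
    fix Q assume Q: "Q \<in> ecarrier (tensor E F) \<and> osum (tensor E F) P Q = Some (eone (tensor E F))"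
    then obtain z where z: "z \<in> formal_sums E F" "Q = tclass E F z"
      using tensor_cases summable_formal_sums by metis
    have "trel E F (x + z) (formal_one E F)"
      using Q x xs z by (simp add: tensor_osum tensor_one tclass_eq split: if_splits)
    then have "trel E F z y" using trel.cancel xs y z by blast
    then show "Q = tclass E F y" using z tclass_eqI by blast
  qed
next
  fix P assume P: "P \<in> ecarrier (tensor E F)"
    and ne: "osum (tensor E F) P (eone (tensor E F)) \<noteq> None"
  then obtain x where x: "x \<in> formal_sums E F" "P = tclass E F x"
    using tensor_cases summable_formal_sums by metis
  have "x + formal_one E F \<in> summable_formal E F"
    using ne x by (simp add: tensor_osum tensor_one split: if_splits)
  then obtain y where "y \<in> formal_sums E F" "trel E F (x + formal_one E F + y) (formal_one E F)"
    by (auto simp: summable_formal_def)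
  then have "trel E F x {#}" using trel.pos x by blast
  then show "P = ezero (tensor E F)" using x tclass_eqI tensor_zero by simp
qed

lemma pure_summable:
  assumes "a \<in> ecarrier E" "b \<in> ecarrier F" shows "{#(a, b)#} \<in> summable_formal E F"
proof -
  obtain a' where a': "a' \<in> ecarrier E" "osum E a a' = Some (eone E)"
    using E.orthosupplement assms by blast
  obtain b' where b': "b' \<in> ecarrier F" "osum F b b' = Some (eone F)"
    using F.orthosupplement assms by blast
  have 1: "trel E F {#(a, b), (a, b')#} {#(a, eone F)#}"
    using assms b' F.one_closed by (intro trel.add_right) auto
  have 2: "trel E F {#(a, eone F), (a', eone F)#} (formal_one E F)"
    unfolding formal_one_def using assms a' E.one_closed F.one_closed by (intro trel.add_left) auto
  have "trel E F ({#(a, b), (a, b')#} + {#(a', eone F)#}) ({#(a, eone F)#} + {#(a', eone F)#})"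
    using 1 a' F.one_closed by (intro trel.add) auto
  then have "trel E F ({#(a, b), (a, b')#} + {#(a', eone F)#}) (formal_one E F)"
    by (rule trel.trans) (use 2 in \<open>simp add: add_mset_commute\<close>)
  moreover have "{#(a, b), (a, b')#} + {#(a', eone F)#} = {#(a, b)#} + {#(a, b'), (a', eone F)#}"
    by simp
  ultimately have "trel E F ({#(a, b)#} + {#(a, b'), (a', eone F)#}) (formal_one E F)"
    by metis
  moreover have "{#(a, b'), (a', eone F)#} \<in> formal_sums E F"
    using assms a' b' F.one_closed by simp
  moreover have "{#(a, b)#} \<in> formal_sums E F" using assms by simp
  ultimately show ?thesis unfolding summable_formal_def by blast
qed

theorem bimorphism_pure: "bimorphism E F (tensor E F) (pure E F)"
  unfolding bimorphism_def biadditive_def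
proof (intro conjI ballI allI impI)
  fix a b assume "a \<in> ecarrier E" "b \<in> ecarrier F"
  then show "pure E F a b \<in> ecarrier (tensor E F)"
    by (simp add: pure_def tclass_in_tensor pure_summable)
next
  fix a a' s b assume *: "a \<in> ecarrier E" "a' \<in> ecarrier E" "b \<in> ecarrier F" "osum E a a' = Some s"
  then have s: "s \<in> ecarrier E" using E.osum_closed by blast
  have r: "trel E F ({#(a, b)#} + {#(a', b)#}) {#(s, b)#}"
    using trel.add_left[OF *(1,2,4) s *(3)] by (simp add: add_mset_commute)
  have f: "{#(a, b)#} \<in> formal_sums E F" "{#(a', b)#} \<in> formal_sums E F" using * by simp_all
  show "osum (tensor E F) (pure E F a b) (pure E F a' b) = Some (pure E F s b)"
    unfolding pure_def tensor_osum[OF f] tclass_eqI[OF r] summable_formal_trel[OF r]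
    using pure_summable[OF s *(3)] by (simp only: if_True)
next
  fix a b b' s assume *: "a \<in> ecarrier E" "b \<in> ecarrier F" "b' \<in> ecarrier F" "osum F b b' = Some s"
  then have s: "s \<in> ecarrier F" using F.osum_closed by blast
  have r: "trel E F ({#(a, b)#} + {#(a, b')#}) {#(a, s)#}"
    using trel.add_right[OF *(1,2,3,4) s] by (simp add: add_mset_commute)
  have f: "{#(a, b)#} \<in> formal_sums E F" "{#(a, b')#} \<in> formal_sums E F" using * by simp_all
  show "osum (tensor E F) (pure E F a b) (pure E F a b') = Some (pure E F a s)"
    unfolding pure_def tensor_osum[OF f] tclass_eqI[OF r] summable_formal_trel[OF r]
    using pure_summable[OF *(1) s] by (simp only: if_True)
next
  show "pure E F (eone E) (eone F) = eone (tensor E F)"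
    by (simp add: pure_def tensor_one formal_one_def)
qed

lemma pure_closed: "a \<in> ecarrier E \<Longrightarrow> b \<in> ecarrier F \<Longrightarrow> pure E F a b \<in> ecarrier (tensor E F)"
  by (simp add: pure_def tclass_in_tensor pure_summable)

end

lemma additive_zero:
  assumes "effect_algebra E" "effect_algebra F" "f \<in> additive_maps E F"
  shows "f (ezero E) = ezero F"
proof -
  interpret E: effect_algebra E by fact
  interpret F: effect_algebra F by fact
  have "f (ezero E) \<in> ecarrier F" "osum F (f (ezero E)) (f (ezero E)) = Some (f (ezero E))"
    using assms(3) E.zero_closed E.osum_zero by (auto simp: additive_maps_def)
  then show ?thesis using F.osum_self_zero by blast
qed

text \<open>Additive maps on the tensor correspond to biadditive maps, also when these do not preserve 1.\<close>

locale ealg_target = ealg_pair E F + G: effect_algebra G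
  for E :: "'a ealg" and F :: "'b ealg" and G :: "'c ealg"
begin

definition lift :: "('a \<Rightarrow> 'b \<Rightarrow> 'c) \<Rightarrow> ('a \<times> 'b) multiset set \<Rightarrow> 'c" where
  "lift h = (\<lambda>P\<in>ecarrier (tensor E F).
     THE v. \<forall>x\<in>P. G.msum (case_prod h) x = Some v)"

lemma msum_trel:
  assumes h: "biadditive E F G h" and r: "trel E F x y"
  shows "G.msum (case_prod h) x = G.msum (case_prod h) y"
  using r
proof (induction rule: trel.induct)
  case (add x y z)
  then show ?case by (simp add: G.msum_union)
next
  case (add_left a a' s b)
  then show ?case using h unfolding biadditive_def
    by (subst G.msum_pair) (auto simp: G.padd_def G.zero_closed G.osum_zero_right)
next
  case (add_right a b b' s)
  then show ?case using h unfolding biadditive_def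
    by (subst G.msum_pair) (auto simp: G.padd_def G.zero_closed G.osum_zero_right)
next
  case (cancel x y z)
  let ?m = "G.msum (case_prod h)"
  have one: "?m (formal_one E F) = Some (h (eone E) (eone F))"
    using h E.one_closed F.one_closed
    by (simp add: formal_one_def biadditive_def G.padd_def G.zero_closed G.osum_zero_right)
  obtain u v where uv: "?m x = Some u" "?m y = Some v" "osum G u v = Some (h (eone E) (eone F))"
    using cancel one by (auto simp: G.msum_union bind_eq_Some_conv)
  obtain w where w: "?m z = Some w" "osum G u w = Some (h (eone E) (eone F))"
    using cancel one uv by (auto simp: G.msum_union bind_eq_Some_conv)
  show ?case using uv w G.osum_cancel G.msum_closed by metis
next
  case (pos x y)
  let ?m = "G.msum (case_prod h)"
  let ?o = "h (eone E) (eone F)"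
  have oc: "?o \<in> ecarrier G" using h E.one_closed F.one_closed by (simp add: biadditive_def)
  have one: "?m (formal_one E F) = Some ?o"
    using oc by (simp add: formal_one_def G.padd_def G.zero_closed G.osum_zero_right)
  obtain u w v where u: "?m x = Some u" "osum G u ?o = Some w" "?m y = Some v" "osum G w v = Some ?o"
    using pos one by (auto simp: G.msum_union bind_eq_Some_conv)
  have uc: "u \<in> ecarrier G" "v \<in> ecarrier G" using u G.msum_closed by blast+
  have wc: "w \<in> ecarrier G" using u uc oc G.osum_closed by blast
  have "Option.bind (osum G ?o u) (\<lambda>s. osum G s v) = Some ?o"
    using u uc oc G.osum_commute[of ?o u] by simp
  then obtain t where t: "osum G u v = Some t" "osum G ?o t = Some ?o"
    using G.osum_assoc[OF oc uc] by (auto simp: bind_eq_Some_conv)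
  then have tc: "t \<in> ecarrier G" using uc G.osum_closed by blast
  have "t = ezero G" using t tc oc G.osum_self_zero by blast
  then have uv: "osum G u v = Some (ezero G)" using t by simp
  obtain s where s: "osum G u (eone G) = Some s"
  proof -
    have "Option.bind (osum G v u) (\<lambda>s. osum G s (eone G)) = Some (eone G)"
      using uv uc G.osum_commute[of u v] G.osum_zero G.one_closed by simp
    then show ?thesis using that G.osum_assoc[OF uc(2,1) G.one_closed]
      by (auto simp: bind_eq_Some_conv)
  qed
  then have "u = ezero G" using G.zero_one_law uc by simp
  then show ?case using u by simp
qed auto

lemma msum_summable:
  assumes h: "biadditive E F G h" and x: "x \<in> summable_formal E F"
  obtains v where "G.msum (case_prod h) x = Some v"
proof -
  obtain y where "trel E F (x + y) (formal_one E F)" using x by (auto simp: summable_formal_def)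
  then have "G.msum (case_prod h) (x + y) = G.msum (case_prod h) (formal_one E F)"
    using msum_trel h by blast
  also have "\<dots> = Some (h (eone E) (eone F))"
    using h E.one_closed F.one_closed
    by (simp add: formal_one_def biadditive_def G.padd_def G.zero_closed G.osum_zero_right)
  finally show ?thesis using that by (auto simp: G.msum_union bind_eq_Some_conv)
qed

lemma lift_tclass:
  assumes h: "biadditive E F G h" and x: "x \<in> summable_formal E F"
  shows "G.msum (case_prod h) x = Some (lift h (tclass E F x))"
proof -
  obtain v where v: "G.msum (case_prod h) x = Some v" using msum_summable assms by blast
  have all: "\<forall>y\<in>tclass E F x. G.msum (case_prod h) y = Some v"
    using v msum_trel[OF h] by (auto simp: tclass_def)
  have "x \<in> tclass E F x" using x summable_formal_sums by (simp add: tclass_def trel.refl)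
  then have "(THE v. \<forall>y\<in>tclass E F x. G.msum (case_prod h) y = Some v) = v"
    using all by (intro the_equality) auto
  then show ?thesis using v x by (simp add: lift_def tclass_in_tensor summable_formal_sums)
qed

lemma lift_additive:
  assumes h: "biadditive E F G h" shows "lift h \<in> additive_maps (tensor E F) G"
  unfolding additive_maps_def
proof (safe intro!: PiE_I)
  fix P assume "P \<in> ecarrier (tensor E F)"
  then show "lift h P \<in> ecarrier G" using lift_tclass[OF h] G.msum_closed by (metis tensor_cases)
next
  fix P assume "P \<notin> ecarrier (tensor E F)"
  then show "lift h P = undefined" by (simp add: lift_def)
next
  fix P Q R assume "P \<in> ecarrier (tensor E F)" "Q \<in> ecarrier (tensor E F)"
    and s: "osum (tensor E F) P Q = Some R"
  then obtain x y where xy: "x \<in> summable_formal E F" "P = tclass E F x"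
    "y \<in> summable_formal E F" "Q = tclass E F y" by (metis tensor_cases)
  then have "x + y \<in> summable_formal E F" "R = tclass E F (x + y)"
    using s by (simp_all add: tensor_osum summable_formal_sums split: if_splits)
  then show "osum G (lift h P) (lift h Q) = Some (lift h R)"
    using xy lift_tclass[OF h, of x] lift_tclass[OF h, of y] lift_tclass[OF h, of "x + y"]
    by (simp add: G.msum_union)
qed

lemma lift_pure:
  assumes "biadditive E F G h" "a \<in> ecarrier E" "b \<in> ecarrier F"
  shows "lift h (pure E F a b) = h a b"
  using lift_tclass[OF assms(1) pure_summable[OF assms(2,3)]] assms
  by (simp add: pure_def biadditive_def G.padd_def G.zero_closed G.osum_zero_right)

lemma additive_eqI:
  assumes k: "k \<in> additive_maps (tensor E F) G" and k': "k' \<in> additive_maps (tensor E F) G"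
    and eq: "\<And>a b. a \<in> ecarrier E \<Longrightarrow> b \<in> ecarrier F \<Longrightarrow> k (pure E F a b) = k' (pure E F a b)"
  shows "k = k'"
proof (rule extensionalityI)
  show "k \<in> extensional (ecarrier (tensor E F))" "k' \<in> extensional (ecarrier (tensor E F))"
    using k k' by (auto simp: additive_maps_def PiE_def)
  fix P assume "P \<in> ecarrier (tensor E F)"
  then obtain x where x: "x \<in> summable_formal E F" "P = tclass E F x" by (rule tensor_cases)
  have "k (tclass E F x) = k' (tclass E F x)" using x(1)
  proof (induction x)
    case empty
    note z = additive_zero[OF effect_algebra_tensor G.effect_algebra_axioms, unfolded tensor_zero]
    show ?case using z[OF k] z[OF k'] by simp
  next
    case (add p x)
    obtain a b where p: "p = (a, b)" by fastforce
    have ab: "a \<in> ecarrier E" "b \<in> ecarrier F" "x \<in> formal_sums E F"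
      using add.prems p by (auto simp: summable_formal_def)
    have x: "x \<in> summable_formal E F" using add.prems summable_formal_right[of "{#p#}" x] by simp
    have s: "osum (tensor E F) (pure E F a b) (tclass E F x) = Some (tclass E F (add_mset p x))"
      using add.prems ab p by (simp add: pure_def tensor_osum)
    have c: "pure E F a b \<in> ecarrier (tensor E F)" "tclass E F x \<in> ecarrier (tensor E F)"
      using ab x by (simp_all add: pure_closed tclass_in_tensor)
    have "osum G (k (pure E F a b)) (k (tclass E F x)) = Some (k (tclass E F (add_mset p x)))"
      "osum G (k' (pure E F a b)) (k' (tclass E F x)) = Some (k' (tclass E F (add_mset p x)))"
      using k k' s c unfolding additive_maps_def by blast+
    then show ?case using add.IH[OF x] eq ab by simp
  qed
  then show "k P = k' P" using x by simp
qed

theorem tensor_universal: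
  assumes "bimorphism E F G h"
  shows "\<exists>!k. k \<in> ealg_hom (tensor E F) G \<and>
    (\<forall>a\<in>ecarrier E. \<forall>b\<in>ecarrier F. k (pure E F a b) = h a b)"
proof (rule ex1I[of _ "lift h"])
  have b: "biadditive E F G h" and one: "h (eone E) (eone F) = eone G"
    using assms by (auto simp: bimorphism_def)
  have "lift h (eone (tensor E F)) = eone G"
    using lift_pure[OF b E.one_closed F.one_closed] one bimorphism_pure
    by (simp add: bimorphism_def)
  then show l: "lift h \<in> ealg_hom (tensor E F) G \<and>
      (\<forall>a\<in>ecarrier E. \<forall>b\<in>ecarrier F. lift h (pure E F a b) = h a b)"
    using lift_additive[OF b] lift_pure[OF b] by (simp add: ealg_hom_def)
  fix k assume "k \<in> ealg_hom (tensor E F) G \<and>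
      (\<forall>a\<in>ecarrier E. \<forall>b\<in>ecarrier F. k (pure E F a b) = h a b)"
  then show "k = lift h" using l by (intro additive_eqI) (auto simp: ealg_hom_def)
qed

lemma lift_osum:
  assumes h: "biadditive E F G h1" "biadditive E F G h2" "biadditive E F G h3"
    and s: "\<And>a b. a \<in> ecarrier E \<Longrightarrow> b \<in> ecarrier F \<Longrightarrow> osum G (h1 a b) (h2 a b) = Some (h3 a b)"
    and P: "P \<in> ecarrier (tensor E F)"
  shows "osum G (lift h1 P) (lift h2 P) = Some (lift h3 P)"
proof -
  obtain x where x: "x \<in> summable_formal E F" "P = tclass E F x" using P by (rule tensor_cases)
  have "osum G (lift h1 (tclass E F x)) (lift h2 (tclass E F x)) = Some (lift h3 (tclass E F x))"
    using x(1)
  proof (induction x)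
    case empty
    have "tclass E F {#} = ezero (tensor E F)" by (simp add: tensor_zero)
    then show ?case
      using additive_zero[OF effect_algebra_tensor G.effect_algebra_axioms lift_additive] h
      by (simp add: G.osum_zero G.zero_closed)
  next
    case (add p x)
    obtain a b where p: "p = (a, b)" by fastforce
    have ab: "a \<in> ecarrier E" "b \<in> ecarrier F"
      using add.prems p by (auto simp: summable_formal_def)
    have x: "x \<in> summable_formal E F" using add.prems summable_formal_right[of "{#p#}" x] by simp
    let ?l = "\<lambda>h x. lift h (tclass E F x)"
    have step: "osum G (h a b) (?l h x) = Some (?l h (add_mset p x)) \<and> h a b \<in> ecarrier G \<and>
        ?l h x \<in> ecarrier G \<and> ?l h (add_mset p x) \<in> ecarrier G"
      if "biadditive E F G h" for h
    proof -
      have c: "h a b \<in> ecarrier G" using that ab by (simp add: biadditive_def)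
      have "G.padd (h a b) (Some (?l h x)) = Some (?l h (add_mset p x))"
        using lift_tclass[OF that x] lift_tclass[OF that add.prems] p by simp
      then show ?thesis
        using c G.msum_closed[OF lift_tclass[OF that x]] G.msum_closed[OF lift_tclass[OF that add.prems]]
        by (auto simp: G.padd_def split: if_splits)
    qed
    have 1: "osum G (h1 a b) (h2 a b) = Some (h3 a b)" using s ab by blast
    note IH = add.IH[OF x]
    define H where "H = (\<lambda>i::nat. if i = 0 then h1 a b else if i = 1 then h2 a b
      else if i = 2 then ?l h1 x else ?l h2 x)"
    have "G.msum H ({#0, 1#} + {#2, 3#}) = Some (?l h3 (add_mset p x))"
      using 1 IH step[OF h(1)] step[OF h(2)] step[OF h(3)]
      by (subst G.msum_union) (simp add: H_def G.padd_def G.zero_closed G.osum_zero_right)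
    moreover have "{#0, 1#} + {#2, 3#} = {#0, 2#} + {#1, 3::nat#}" by simp
    ultimately have "G.msum H ({#0, 2#} + {#1, 3#}) = Some (?l h3 (add_mset p x))" by metis
    then show ?case
      using step[OF h(1)] step[OF h(2)]
      by (subst (asm) G.msum_union) (simp add: H_def G.padd_def G.zero_closed G.osum_zero_right)
  qed
  then show ?thesis using x by simp
qed

end

definition tensor_lift ::
  "'a ealg \<Rightarrow> 'b ealg \<Rightarrow> 'c ealg \<Rightarrow> ('a \<Rightarrow> 'b \<Rightarrow> 'c) \<Rightarrow> ('a \<times> 'b) multiset set \<Rightarrow> 'c" where
  "tensor_lift E F G h = (THE k. k \<in> ealg_hom (tensor E F) G \<and>
     (\<forall>a\<in>ecarrier E. \<forall>b\<in>ecarrier F. k (pure E F a b) = h a b))"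

definition tensor_map :: "'a ealg \<Rightarrow> 'b ealg \<Rightarrow> 'c ealg \<Rightarrow> 'd ealg \<Rightarrow> ('a \<Rightarrow> 'c) \<Rightarrow> ('b \<Rightarrow> 'd) \<Rightarrow>
    ('a \<times> 'b) multiset set \<Rightarrow> ('c \<times> 'd) multiset set" where
  "tensor_map E F E' F' f g = tensor_lift E F (tensor E' F') (\<lambda>a b. pure E' F' (f a) (g b))"

text \<open>The coherence isomorphisms \<open>E \<otimes> (F \<otimes> G) \<cong> (E \<otimes> F) \<otimes> G\<close> and
  \<open>(E \<otimes> F) \<otimes> (G \<otimes> H) \<cong> (E \<otimes> G) \<otimes> (F \<otimes> H)\<close>, determined by their values on pure tensors;
  see \<open>assoc_unique\<close> and \<open>interchange_unique\<close>.\<close>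

definition tensor_assoc where
  "tensor_assoc E F G = (THE k. k \<in> ealg_hom (tensor E (tensor F G)) (tensor (tensor E F) G) \<and>
     (\<forall>a\<in>ecarrier E. \<forall>b\<in>ecarrier F. \<forall>c\<in>ecarrier G.
        k (pure E (tensor F G) a (pure F G b c)) = pure (tensor E F) G (pure E F a b) c))"

definition tensor_interchange where
  "tensor_interchange E F G H = (THE k.
     k \<in> ealg_hom (tensor (tensor E F) (tensor G H)) (tensor (tensor E G) (tensor F H)) \<and>
     (\<forall>a\<in>ecarrier E. \<forall>b\<in>ecarrier F. \<forall>c\<in>ecarrier G. \<forall>d\<in>ecarrier H.
        k (pure (tensor E F) (tensor G H) (pure E F a b) (pure G H c d)) =
        pure (tensor E G) (tensor F H) (pure E G a c) (pure F H b d)))"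


lemma effect_algebra_pair: "effect_algebra E \<Longrightarrow> effect_algebra F \<Longrightarrow> ealg_pair E F"
  by (simp add: ealg_pair_def)

lemma effect_algebra_target:
  "effect_algebra E \<Longrightarrow> effect_algebra F \<Longrightarrow> effect_algebra G \<Longrightarrow> ealg_target E F G"
  by (simp add: ealg_target_def ealg_pair_def)

lemma effect_algebra_tensorI: "effect_algebra E \<Longrightarrow> effect_algebra F \<Longrightarrow> effect_algebra (tensor E F)"
  by (simp add: ealg_pair.effect_algebra_tensor effect_algebra_pair)

lemma biadditive_pure:
  "effect_algebra E \<Longrightarrow> effect_algebra F \<Longrightarrow> biadditive E F (tensor E F) (pure E F)"
  using ealg_pair.bimorphism_pure effect_algebra_pair by (auto simp: bimorphism_def)

lemma pure_one:
  "effect_algebra E \<Longrightarrow> effect_algebra F \<Longrightarrow> pure E F (eone E) (eone F) = eone (tensor E F)"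
  using ealg_pair.bimorphism_pure effect_algebra_pair by (auto simp: bimorphism_def)

lemma biadditiveD:
  assumes "biadditive E F G h"
  shows "a \<in> ecarrier E \<Longrightarrow> b \<in> ecarrier F \<Longrightarrow> h a b \<in> ecarrier G"
    and "\<lbrakk>a \<in> ecarrier E; a' \<in> ecarrier E; osum E a a' = Some s; b \<in> ecarrier F\<rbrakk> \<Longrightarrow>
        osum G (h a b) (h a' b) = Some (h s b)"
    and "\<lbrakk>b \<in> ecarrier F; b' \<in> ecarrier F; osum F b b' = Some t; a \<in> ecarrier E\<rbrakk> \<Longrightarrow>
        osum G (h a b) (h a b') = Some (h a t)"
  using assms by (simp_all add: biadditive_def)

lemma biadditive_slices:
  assumes "effect_algebra F" "biadditive E F G h" "k \<in> additive_maps G X"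
  shows "a \<in> ecarrier E \<Longrightarrow> (\<lambda>b\<in>ecarrier F. k (h a b)) \<in> additive_maps F X"
    and "effect_algebra E \<Longrightarrow> b \<in> ecarrier F \<Longrightarrow> (\<lambda>a\<in>ecarrier E. k (h a b)) \<in> additive_maps E X"
proof -
  interpret F: effect_algebra F by fact
  have 1: "h a b \<in> ecarrier G" if "a \<in> ecarrier E" "b \<in> ecarrier F" for a b
    using assms(2) that by (simp add: biadditive_def)
  have 2: "k u \<in> ecarrier X" if "u \<in> ecarrier G" for u
    using assms(3) that by (auto simp: additive_maps_def)
  have 3: "osum X (k u) (k v) = Some (k w)"
    if "u \<in> ecarrier G" "v \<in> ecarrier G" "osum G u v = Some w" for u v w
    using assms(3) that by (auto simp: additive_maps_def)
  { assume a: "a \<in> ecarrier E"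
    show "(\<lambda>b\<in>ecarrier F. k (h a b)) \<in> additive_maps F X"
      unfolding additive_maps_def
    proof (safe intro!: restrict_PiE_iff[THEN iffD2])
      fix b b' c assume *: "b \<in> ecarrier F" "b' \<in> ecarrier F" "osum F b b' = Some c"
      have "osum G (h a b) (h a b') = Some (h a c)"
        using assms(2) a * unfolding biadditive_def by blast
      then show "osum X (restrict (\<lambda>b. k (h a b)) (ecarrier F) b)
          (restrict (\<lambda>b. k (h a b)) (ecarrier F) b') =
          Some (restrict (\<lambda>b. k (h a b)) (ecarrier F) c)"
        using 3[OF 1[OF a *(1)] 1[OF a *(2)]] * F.osum_closed[OF *] by simp
    qed (use 1 2 a in auto) }
  { assume E: "effect_algebra E" and b: "b \<in> ecarrier F"
    show "(\<lambda>a\<in>ecarrier E. k (h a b)) \<in> additive_maps E X"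
      unfolding additive_maps_def
    proof (safe intro!: restrict_PiE_iff[THEN iffD2])
      fix a a' c assume *: "a \<in> ecarrier E" "a' \<in> ecarrier E" "osum E a a' = Some c"
      have "osum G (h a b) (h a' b) = Some (h c b)"
        using assms(2) b * unfolding biadditive_def by blast
      then show "osum X (restrict (\<lambda>a. k (h a b)) (ecarrier E) a)
          (restrict (\<lambda>a. k (h a b)) (ecarrier E) a') =
          Some (restrict (\<lambda>a. k (h a b)) (ecarrier E) c)"
        using 3[OF 1[OF *(1) b] 1[OF *(2) b]] * effect_algebra.osum_closed[OF E *] by simp
    qed (use 1 2 b in auto) }
qed

theorem assoc_unique:
  assumes E: "effect_algebra E" and F: "effect_algebra F" and G: "effect_algebra G"
  shows "\<exists>!k. k \<in> ealg_hom (tensor E (tensor F G)) (tensor (tensor E F) G) \<and>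
     (\<forall>a\<in>ecarrier E. \<forall>b\<in>ecarrier F. \<forall>c\<in>ecarrier G.
        k (pure E (tensor F G) a (pure F G b c)) = pure (tensor E F) G (pure E F a b) c)"
proof -
  let ?X = "tensor (tensor E F) G"
  have X: "effect_algebra ?X" and EF: "effect_algebra (tensor E F)"
    and FG: "effect_algebra (tensor F G)"
    using E F G by (simp_all add: effect_algebra_tensorI)
  interpret FGX: ealg_target F G ?X using F G X by (rule effect_algebra_target)
  interpret O: ealg_target E "tensor F G" ?X using E FG X by (rule effect_algebra_target)
  define h where "h a b c = pure (tensor E F) G (pure E F a b) c" for a b c
  have p: "biadditive E F (tensor E F) (pure E F)"
    and q: "biadditive (tensor E F) G ?X (pure (tensor E F) G)"
    using E F G EF by (simp_all add: biadditive_pure)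
  have h: "biadditive F G ?X (h a)" if "a \<in> ecarrier E" for a
    unfolding biadditive_def h_def
    by (intro conjI ballI allI impI biadditiveD(1)[OF q] biadditiveD(2,3)[OF q] biadditiveD(3)[OF p]
        biadditiveD(1)[OF p] that)
  have ha: "osum ?X (h a b c) (h a' b c) = Some (h s b c)"
    if "a \<in> ecarrier E" "a' \<in> ecarrier E" "osum E a a' = Some s"
      "b \<in> ecarrier F" "c \<in> ecarrier G" for a a' s b c
    unfolding h_def
    by (intro biadditiveD(2)[OF q] biadditiveD(2)[OF p] biadditiveD(1)[OF p] that)
  let ?l = "\<lambda>a. FGX.lift (h a)"
  have add: "?l a \<in> additive_maps (tensor F G) ?X" if "a \<in> ecarrier E" for a
    using h[OF that] by (rule FGX.lift_additive)
  have l: "biadditive E (tensor F G) ?X ?l"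
    unfolding biadditive_def
  proof (intro conjI ballI allI impI)
    fix a t assume "a \<in> ecarrier E" "t \<in> ecarrier (tensor F G)"
    then show "?l a t \<in> ecarrier ?X" using add by (auto simp: additive_maps_def)
  next
    fix a a' s t assume *: "a \<in> ecarrier E" "a' \<in> ecarrier E" "t \<in> ecarrier (tensor F G)"
      "osum E a a' = Some s"
    have s: "s \<in> ecarrier E" using O.E.osum_closed * by blast
    show "osum ?X (?l a t) (?l a' t) = Some (?l s t)"
      by (rule FGX.lift_osum[OF h[OF *(1)] h[OF *(2)] h[OF s] ha[OF *(1,2,4)] *(3)])
  next
    fix a t t' s assume "a \<in> ecarrier E" "t \<in> ecarrier (tensor F G)"
      "t' \<in> ecarrier (tensor F G)" "osum (tensor F G) t t' = Some s"
    then show "osum ?X (?l a t) (?l a t') = Some (?l a s)"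
      using add by (auto simp: additive_maps_def)
  qed
  have lp: "?l a (pure F G b c) = h a b c"
    if "a \<in> ecarrier E" "b \<in> ecarrier F" "c \<in> ecarrier G" for a b c
    by (rule FGX.lift_pure[OF h[OF that(1)] that(2,3)])
  show ?thesis
  proof (rule ex_ex1I)
    let ?k = "O.lift ?l"
    have v: "?k (pure E (tensor F G) a (pure F G b c)) = h a b c"
      if "a \<in> ecarrier E" "b \<in> ecarrier F" "c \<in> ecarrier G" for a b c
      using O.lift_pure[OF l that(1) FGX.pure_closed[OF that(2,3)]] lp[OF that] by simp
    have "?k (eone (tensor E (tensor F G))) = eone ?X"
      using v[OF O.E.one_closed FGX.E.one_closed FGX.F.one_closed] E F G EF FG
      by (simp add: pure_one h_def)
    then show "\<exists>k. k \<in> ealg_hom (tensor E (tensor F G)) ?X \<and>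
     (\<forall>a\<in>ecarrier E. \<forall>b\<in>ecarrier F. \<forall>c\<in>ecarrier G.
        k (pure E (tensor F G) a (pure F G b c)) = pure (tensor E F) G (pure E F a b) c)"
      using v O.lift_additive[OF l] by (intro exI[of _ ?k]) (simp add: ealg_hom_def h_def)
  next
    fix k k'
    assume k: "k \<in> ealg_hom (tensor E (tensor F G)) ?X \<and>
     (\<forall>a\<in>ecarrier E. \<forall>b\<in>ecarrier F. \<forall>c\<in>ecarrier G.
        k (pure E (tensor F G) a (pure F G b c)) = pure (tensor E F) G (pure E F a b) c)"
      and k': "k' \<in> ealg_hom (tensor E (tensor F G)) ?X \<and>
     (\<forall>a\<in>ecarrier E. \<forall>b\<in>ecarrier F. \<forall>c\<in>ecarrier G.
        k' (pure E (tensor F G) a (pure F G b c)) = pure (tensor E F) G (pure E F a b) c)"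
    note kp = k[THEN conjunct2, rule_format] and k'p = k'[THEN conjunct2, rule_format]
    have ka: "k \<in> additive_maps (tensor E (tensor F G)) ?X"
      "k' \<in> additive_maps (tensor E (tensor F G)) ?X"
      using k[THEN conjunct1] k'[THEN conjunct1] by (simp_all add: ealg_hom_def)
    have r: "biadditive E (tensor F G) (tensor E (tensor F G)) (pure E (tensor F G))"
      using E FG by (rule biadditive_pure)
    show "k = k'"
    proof (rule O.additive_eqI[OF ka])
      fix a t assume a: "a \<in> ecarrier E" and t: "t \<in> ecarrier (tensor F G)"
      have "(\<lambda>t\<in>ecarrier (tensor F G). k (pure E (tensor F G) a t)) =
            (\<lambda>t\<in>ecarrier (tensor F G). k' (pure E (tensor F G) a t))"
        (is "?f = ?g")
        by (rule FGX.additive_eqI[OF biadditive_slices(1)[OF FG r ka(1) a]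
              biadditive_slices(1)[OF FG r ka(2) a]])
          (simp add: FGX.pure_closed kp k'p a)
      then have "?f t = ?g t" by (rule fun_cong)
      then show "k (pure E (tensor F G) a t) = k' (pure E (tensor F G) a t)" using t by simp
    qed
  qed
qed

theorem interchange_unique:
  assumes E: "effect_algebra E" and F: "effect_algebra F"
    and G: "effect_algebra G" and H: "effect_algebra H"
  shows "\<exists>!k. k \<in> ealg_hom (tensor (tensor E F) (tensor G H)) (tensor (tensor E G) (tensor F H)) \<and>
     (\<forall>a\<in>ecarrier E. \<forall>b\<in>ecarrier F. \<forall>c\<in>ecarrier G. \<forall>d\<in>ecarrier H.
        k (pure (tensor E F) (tensor G H) (pure E F a b) (pure G H c d)) =
        pure (tensor E G) (tensor F H) (pure E G a c) (pure F H b d))"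
proof -
  let ?X = "tensor (tensor E G) (tensor F H)"
  let ?EF = "tensor E F" and ?GH = "tensor G H"
  have EF: "effect_algebra ?EF" and GH: "effect_algebra ?GH"
    and EG: "effect_algebra (tensor E G)" and FH: "effect_algebra (tensor F H)"
    using E F G H by (simp_all add: effect_algebra_tensorI)
  have X: "effect_algebra ?X" using EG FH by (rule effect_algebra_tensorI)
  interpret A: ealg_target G H ?X using G H X by (rule effect_algebra_target)
  interpret B: ealg_target E F ?X using E F X by (rule effect_algebra_target)
  interpret O: ealg_target ?EF ?GH ?X using EF GH X by (rule effect_algebra_target)
  define h where "h a b c d = pure (tensor E G) (tensor F H) (pure E G a c) (pure F H b d)"
    for a b c d
  have p: "biadditive E G (tensor E G) (pure E G)" "biadditive F H (tensor F H) (pure F H)"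
    and q: "biadditive (tensor E G) (tensor F H) ?X (pure (tensor E G) (tensor F H))"
    using E F G H EG FH by (simp_all add: biadditive_pure)
  note pc = biadditiveD(1)[OF p(1)] biadditiveD(1)[OF p(2)]
  have hc: "h a b c d \<in> ecarrier ?X"
    if "a \<in> ecarrier E" "b \<in> ecarrier F" "c \<in> ecarrier G" "d \<in> ecarrier H" for a b c d
    unfolding h_def by (intro biadditiveD(1)[OF q] pc that)
  have hab: "osum ?X (h a b c d) (h a' b c d) = Some (h s b c d)"
    if "a \<in> ecarrier E" "a' \<in> ecarrier E" "osum E a a' = Some s"
      "b \<in> ecarrier F" "c \<in> ecarrier G" "d \<in> ecarrier H" for a a' s b c d
    unfolding h_def by (intro biadditiveD(2)[OF q] biadditiveD(2)[OF p(1)] pc that)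
  have hb: "osum ?X (h a b c d) (h a b' c d) = Some (h a s c d)"
    if "a \<in> ecarrier E" "b \<in> ecarrier F" "b' \<in> ecarrier F" "osum F b b' = Some s"
      "c \<in> ecarrier G" "d \<in> ecarrier H" for a b b' s c d
    unfolding h_def by (intro biadditiveD(3)[OF q] biadditiveD(2)[OF p(2)] pc that)
  have hcc: "osum ?X (h a b c d) (h a b c' d) = Some (h a b s d)"
    if "a \<in> ecarrier E" "b \<in> ecarrier F" "c \<in> ecarrier G" "c' \<in> ecarrier G"
      "osum G c c' = Some s" "d \<in> ecarrier H" for a b c c' s d
    unfolding h_def by (intro biadditiveD(2)[OF q] biadditiveD(3)[OF p(1)] pc that)
  have hd: "osum ?X (h a b c d) (h a b c d') = Some (h a b c s)"
    if "a \<in> ecarrier E" "b \<in> ecarrier F" "c \<in> ecarrier G" "d \<in> ecarrier H"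
      "d' \<in> ecarrier H" "osum H d d' = Some s" for a b c d d' s
    unfolding h_def by (intro biadditiveD(3)[OF q] biadditiveD(3)[OF p(2)] pc that)
  have h: "biadditive G H ?X (h a b)" if "a \<in> ecarrier E" "b \<in> ecarrier F" for a b
    using hc[OF that] hcc[OF that] hd[OF that] by (simp add: biadditive_def)
  let ?l = "\<lambda>t a b. A.lift (h a b) t"
  have add: "A.lift (h a b) \<in> additive_maps ?GH ?X" if "a \<in> ecarrier E" "b \<in> ecarrier F" for a b
    using h[OF that] by (rule A.lift_additive)
  have l: "biadditive E F ?X (?l t)" if t: "t \<in> ecarrier ?GH" for t
    unfolding biadditive_def
  proof (intro conjI ballI allI impI)
    fix a b assume "a \<in> ecarrier E" "b \<in> ecarrier F"
    then show "?l t a b \<in> ecarrier ?X" using add t by (auto simp: additive_maps_def)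
  next
    fix a a' s b assume *: "a \<in> ecarrier E" "a' \<in> ecarrier E" "b \<in> ecarrier F"
      "osum E a a' = Some s"
    have s: "s \<in> ecarrier E" using B.E.osum_closed * by blast
    show "osum ?X (?l t a b) (?l t a' b) = Some (?l t s b)"
      by (rule A.lift_osum[OF h[OF *(1,3)] h[OF *(2,3)] h[OF s *(3)] hab[OF *(1,2,4,3)] t])
  next
    fix a b b' s assume *: "a \<in> ecarrier E" "b \<in> ecarrier F" "b' \<in> ecarrier F"
      "osum F b b' = Some s"
    have s: "s \<in> ecarrier F" using B.F.osum_closed * by blast
    show "osum ?X (?l t a b) (?l t a b') = Some (?l t a s)"
      by (rule A.lift_osum[OF h[OF *(1,2)] h[OF *(1,3)] h[OF *(1) s] hb[OF *] t])
  qed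
  let ?L = "\<lambda>s t. B.lift (?l t) s"
  have L: "biadditive ?EF ?GH ?X ?L"
    unfolding biadditive_def
  proof (intro conjI ballI allI impI)
    fix s t assume "s \<in> ecarrier ?EF" "t \<in> ecarrier ?GH"
    then show "?L s t \<in> ecarrier ?X" using B.lift_additive[OF l] by (auto simp: additive_maps_def)
  next
    fix s s' u t assume "s \<in> ecarrier ?EF" "s' \<in> ecarrier ?EF" "t \<in> ecarrier ?GH"
      "osum ?EF s s' = Some u"
    then show "osum ?X (?L s t) (?L s' t) = Some (?L u t)"
      using B.lift_additive[OF l] by (auto simp: additive_maps_def)
  next
    fix s t t' u assume *: "s \<in> ecarrier ?EF" "t \<in> ecarrier ?GH" "t' \<in> ecarrier ?GH"
      "osum ?GH t t' = Some u"
    have u: "u \<in> ecarrier ?GH" using O.F.osum_closed * by blast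
    show "osum ?X (?L s t) (?L s t') = Some (?L s u)"
    proof (rule B.lift_osum[OF l[OF *(2)] l[OF *(3)] l[OF u] _ *(1)])
      fix a b assume "a \<in> ecarrier E" "b \<in> ecarrier F"
      then show "osum ?X (?l t a b) (?l t' a b) = Some (?l u a b)"
        using add * by (auto simp: additive_maps_def)
    qed
  qed
  have Lp: "?L (pure E F a b) (pure G H c d) = h a b c d"
    if "a \<in> ecarrier E" "b \<in> ecarrier F" "c \<in> ecarrier G" "d \<in> ecarrier H" for a b c d
    using B.lift_pure[OF l[OF A.pure_closed[OF that(3,4)]] that(1,2)]
      A.lift_pure[OF h[OF that(1,2)] that(3,4)] by simp
  show ?thesis
  proof (rule ex_ex1I)
    let ?k = "O.lift ?L"
    have v: "?k (pure ?EF ?GH (pure E F a b) (pure G H c d)) = h a b c d"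
      if "a \<in> ecarrier E" "b \<in> ecarrier F" "c \<in> ecarrier G" "d \<in> ecarrier H" for a b c d
      using O.lift_pure[OF L B.pure_closed[OF that(1,2)] A.pure_closed[OF that(3,4)]] Lp[OF that]
      by simp
    have "?k (eone (tensor ?EF ?GH)) = eone ?X"
      using v[OF B.E.one_closed B.F.one_closed A.E.one_closed A.F.one_closed] E F G H EF GH EG FH
      by (simp add: pure_one h_def)
    then show "\<exists>k. k \<in> ealg_hom (tensor ?EF ?GH) ?X \<and>
     (\<forall>a\<in>ecarrier E. \<forall>b\<in>ecarrier F. \<forall>c\<in>ecarrier G. \<forall>d\<in>ecarrier H.
        k (pure ?EF ?GH (pure E F a b) (pure G H c d)) =
        pure (tensor E G) (tensor F H) (pure E G a c) (pure F H b d))"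
      using v O.lift_additive[OF L] by (intro exI[of _ ?k]) (simp add: ealg_hom_def h_def)
  next
    fix k k'
    assume k: "k \<in> ealg_hom (tensor ?EF ?GH) ?X \<and>
     (\<forall>a\<in>ecarrier E. \<forall>b\<in>ecarrier F. \<forall>c\<in>ecarrier G. \<forall>d\<in>ecarrier H.
        k (pure ?EF ?GH (pure E F a b) (pure G H c d)) =
        pure (tensor E G) (tensor F H) (pure E G a c) (pure F H b d))"
      and k': "k' \<in> ealg_hom (tensor ?EF ?GH) ?X \<and>
     (\<forall>a\<in>ecarrier E. \<forall>b\<in>ecarrier F. \<forall>c\<in>ecarrier G. \<forall>d\<in>ecarrier H.
        k' (pure ?EF ?GH (pure E F a b) (pure G H c d)) =
        pure (tensor E G) (tensor F H) (pure E G a c) (pure F H b d))"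
    note kp = k[THEN conjunct2, rule_format] and k'p = k'[THEN conjunct2, rule_format]
    have ka: "k \<in> additive_maps (tensor ?EF ?GH) ?X" "k' \<in> additive_maps (tensor ?EF ?GH) ?X"
      using k[THEN conjunct1] k'[THEN conjunct1] by (simp_all add: ealg_hom_def)
    have r: "biadditive ?EF ?GH (tensor ?EF ?GH) (pure ?EF ?GH)"
      using EF GH by (rule biadditive_pure)
    have 1: "k (pure ?EF ?GH (pure E F a b) t) = k' (pure ?EF ?GH (pure E F a b) t)"
      if ab: "a \<in> ecarrier E" "b \<in> ecarrier F" and t: "t \<in> ecarrier ?GH" for a b t
    proof -
      note s = B.pure_closed[OF ab]
      have "(\<lambda>t\<in>ecarrier ?GH. k (pure ?EF ?GH (pure E F a b) t)) =
            (\<lambda>t\<in>ecarrier ?GH. k' (pure ?EF ?GH (pure E F a b) t))"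
        (is "?f = ?g")
        by (rule A.additive_eqI[OF biadditive_slices(1)[OF GH r ka(1) s]
              biadditive_slices(1)[OF GH r ka(2) s]])
          (simp add: A.pure_closed kp k'p ab)
      then have "?f t = ?g t" by (rule fun_cong)
      then show ?thesis using t by simp
    qed
    show "k = k'"
    proof (rule O.additive_eqI[OF ka])
      fix s t assume s: "s \<in> ecarrier ?EF" and t: "t \<in> ecarrier ?GH"
      have "(\<lambda>s\<in>ecarrier ?EF. k (pure ?EF ?GH s t)) = (\<lambda>s\<in>ecarrier ?EF. k' (pure ?EF ?GH s t))"
        (is "?f = ?g")
        by (rule B.additive_eqI[OF biadditive_slices(2)[OF GH r ka(1) EF t]
              biadditive_slices(2)[OF GH r ka(2) EF t]])
          (simp add: B.pure_closed 1 t)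
      then have "?f s = ?g s" by (rule fun_cong)
      then show "k (pure ?EF ?GH s t) = k' (pure ?EF ?GH s t)" using s by simp
    qed
  qed
qed


section \<open>Boolean algebras and the unit interval\<close>

definition balg :: "'a::boolean_algebra ealg" where
  "balg = \<lparr>ecarrier = UNIV,
     osum = (\<lambda>a b. if inf a b = bot then Some (sup a b) else None),
     ezero = bot, eone = top\<rparr>"

definition boolean_hom :: "('a::boolean_algebra \<Rightarrow> 'b::boolean_algebra) \<Rightarrow> bool" where
  "boolean_hom h \<longleftrightarrow>
     (\<forall>x y. h (inf x y) = inf (h x) (h y)) \<and> (\<forall>x y. h (sup x y) = sup (h x) (h y)) \<and>
     (\<forall>x. h (- x) = - h x) \<and> h bot = bot \<and> h top = top"

abbreviation two :: "bool ealg" where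
  "two \<equiv> balg"

definition unit_interval :: "real ealg" where
  "unit_interval = \<lparr>ecarrier = {0..1},
     osum = (\<lambda>a b. if a + b \<le> 1 then Some (a + b) else None),
     ezero = 0, eone = 1\<rparr>"

definition interval_mult :: "(real \<times> real) multiset set \<Rightarrow> real" where
  "interval_mult = tensor_lift unit_interval unit_interval unit_interval (\<lambda>r s. r * s)"

definition interval_unit :: "bool \<Rightarrow> real" where
  "interval_unit = (THE k. k \<in> ealg_hom two unit_interval)"

text \<open>The codiagonal \<open>[id, id]\<close> of the coproduct \<open>A \<otimes> A\<close>, whose coprojections are
  \<open>a \<mapsto> a \<otimes> 1\<close> and \<open>a \<mapsto> 1 \<otimes> a\<close>; see \<open>tensor_coproduct\<close>.\<close>

definition codiagonal :: "'a ealg \<Rightarrow> ('a \<times> 'a) multiset set \<Rightarrow> 'a" where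
  "codiagonal A = (THE k. k \<in> ealg_hom (tensor A A) A \<and>
     (\<forall>a\<in>ecarrier A. k (pure A A a (eone A)) = a \<and> k (pure A A (eone A) a) = a))"


lemma effect_algebra_balg: "effect_algebra (balg :: 'a::boolean_algebra ealg)"
proof
  fix a b c :: 'a
  show "Option.bind (osum balg a b) (\<lambda>s. osum balg s c) =
        Option.bind (osum balg b c) (\<lambda>t. osum balg a t)"
    by (auto simp: balg_def inf_sup_distrib1 inf_sup_distrib2 sup.assoc)
next
  fix a :: 'a
  show "\<exists>!b. b \<in> ecarrier balg \<and> osum balg a b = Some (eone balg)"
  proof (rule ex1I[of _ "- a"])
    fix b assume "b \<in> ecarrier balg \<and> osum balg a b = Some (eone balg)"
    then have "inf a b = bot" "sup a b = top" by (auto simp: balg_def split: if_splits)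
    then show "b = - a" using compl_unique by metis
  qed (simp add: balg_def)
next
  fix a :: 'a assume "osum balg a (eone balg) \<noteq> None"
  then show "a = ezero balg" by (simp add: balg_def split: if_splits)
qed (auto simp: balg_def inf.commute sup.commute)

lemma effect_algebra_unit_interval: "effect_algebra unit_interval"
proof
  fix a :: real assume "a \<in> ecarrier unit_interval"
  then show "\<exists>!b. b \<in> ecarrier unit_interval \<and> osum unit_interval a b = Some (eone unit_interval)"
    by (intro ex1I[of _ "1 - a"]) (auto simp: unit_interval_def split: if_splits)
qed (auto simp: unit_interval_def split: if_splits)

text \<open>BAlg is a full subcategory of EAlg.\<close>

lemma boolean_hom_iff:
  "boolean_hom h \<longleftrightarrow> h \<in> ealg_hom (balg :: 'a::boolean_algebra ealg) (balg :: 'b::boolean_algebra ealg)"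
proof
  assume h: "boolean_hom h"
  then have "inf (h a) (h b) = bot" if "inf a b = bot" for a b
    using that unfolding boolean_hom_def by metis
  then show "h \<in> ealg_hom balg balg"
    using h by (auto simp: boolean_hom_def ealg_hom_def additive_maps_def balg_def split: if_splits)
next
  assume h: "h \<in> ealg_hom (balg :: 'a ealg) (balg :: 'b ealg)"
  have one: "h top = top" using h by (simp add: ealg_hom_def balg_def)
  have "h \<in> additive_maps balg balg" using h by (simp add: ealg_hom_def)
  then have "\<And>a b. \<forall>c. osum balg a b = Some c \<longrightarrow> osum balg (h a) (h b) = Some (h c)"
    unfolding additive_maps_def by (auto simp: balg_def)
  then have t: "osum balg (h a) (h b) = Some (h (sup a b))" if "inf a b = bot" for a b
    using that by (simp add: balg_def)
  have s: "inf (h a) (h b) = bot \<and> h (sup a b) = sup (h a) (h b)" if "inf a b = bot" for a b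
    using t[OF that] by (simp add: balg_def split: if_splits)
  have neg: "h (- a) = - h a" for a
    using s[of a "- a"] one compl_unique[of "h a" "h (- a)"] by simp
  have zero: "h bot = bot" using neg[of top] one by simp
  have mono: "h a \<le> h b" if "a \<le> b" for a b
  proof -
    have "inf a (inf b (- a)) = bot" by (simp add: inf.left_commute)
    moreover have "sup a (inf b (- a)) = b" using that by (simp add: sup_inf_distrib1 sup.absorb2)
    ultimately show ?thesis using s[of a "inf b (- a)"] by (metis sup.cobounded1)
  qed
  have disj: "inf (h a) (h b) \<le> h (inf a b)" for a b
  proof -
    have "a = sup (inf a b) (inf a (- b))" by (simp flip: inf_sup_distrib1)
    moreover have "inf (inf a b) (inf a (- b)) = bot"
      by (simp add: inf.assoc inf.left_commute)
    ultimately have "h a = sup (h (inf a b)) (h (inf a (- b)))" using s by metis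
    moreover have "inf (h (inf a (- b))) (h b) = bot"
    proof -
      have "h (inf a (- b)) \<le> - h b" using mono[of "inf a (- b)" "- b"] neg[of b] by simp
      then have "inf (h (inf a (- b))) (h b) \<le> inf (- h b) (h b)" by (rule inf_mono) simp
      then show ?thesis by (simp add: bot_unique)
    qed
    ultimately have "inf (h a) (h b) = inf (h (inf a b)) (h b)" by (simp add: inf_sup_distrib2)
    then show ?thesis by simp
  qed
  have inf: "h (inf a b) = inf (h a) (h b)" for a b
    using disj[of a b] mono[of "inf a b" a] mono[of "inf a b" b] by (simp add: order.antisym)
  have "h (sup a b) = sup (h a) (h b)" for a b
    using neg[of "inf (- a) (- b)"] inf[of "- a" "- b"] neg by simp
  then show "boolean_hom h" using inf neg zero one by (simp add: boolean_hom_def)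
qed

lemma bimorphism_mult: "bimorphism unit_interval unit_interval unit_interval (\<lambda>r s. r * s)"
  unfolding bimorphism_def biadditive_def
proof (intro conjI ballI allI impI)
  fix a a' s b assume "a \<in> ecarrier unit_interval" "a' \<in> ecarrier unit_interval"
    "b \<in> ecarrier unit_interval" "osum unit_interval a a' = Some s"
  then have "0 \<le> b" "b \<le> 1" "0 \<le> a" "0 \<le> a'" "s = a + a'" "a + a' \<le> 1"
    by (auto simp: unit_interval_def split: if_splits)
  then show "osum unit_interval (a * b) (a' * b) = Some (s * b)"
    using mult_le_one[of "a + a'" b] by (simp add: unit_interval_def distrib_right)
next
  fix b a a' s assume "a \<in> ecarrier unit_interval" "a' \<in> ecarrier unit_interval"
    "b \<in> ecarrier unit_interval" "osum unit_interval a a' = Some s"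
  then have "0 \<le> b" "b \<le> 1" "0 \<le> a" "0 \<le> a'" "s = a + a'" "a + a' \<le> 1"
    by (auto simp: unit_interval_def split: if_splits)
  then show "osum unit_interval (b * a) (b * a') = Some (b * s)"
    using mult_le_one[of b "a + a'"] by (simp add: unit_interval_def distrib_left)
qed (auto simp: unit_interval_def mult_le_one)

lemma two_initial:
  assumes "effect_algebra E"
  shows "\<exists>!k. k \<in> ealg_hom two E"
proof (rule ex1I[of _ "\<lambda>b. if b then eone E else ezero E"])
  interpret effect_algebra E by fact
  show "(\<lambda>b. if b then eone E else ezero E) \<in> ealg_hom two E"
    using zero_closed one_closed osum_zero osum_zero_right
    by (auto simp: ealg_hom_def additive_maps_def balg_def)
  fix k assume "k \<in> ealg_hom two E"
  then show "k = (\<lambda>b. if b then eone E else ezero E)"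
    using additive_zero[OF effect_algebra_balg assms, of k]
    by (auto simp: ealg_hom_def balg_def)
qed

theorem tensor_coproduct:
  fixes f :: "'a::boolean_algebra \<Rightarrow> 'c::boolean_algebra" and g :: "'b::boolean_algebra \<Rightarrow> 'c"
  assumes f: "boolean_hom f" and g: "boolean_hom g"
  shows "\<exists>!k. k \<in> ealg_hom (tensor balg balg) (balg :: 'c ealg) \<and>
    (\<forall>a. k (pure balg balg a top) = f a) \<and> (\<forall>b. k (pure balg balg top b) = g b)"
    and "\<exists>!k. k \<in> ealg_hom (tensor balg balg) (balg :: 'c ealg) \<and>
    (\<forall>a b. k (pure balg balg a b) = inf (f a) (g b))"
proof -
  let ?A = "balg :: 'a ealg" and ?B = "balg :: 'b ealg" and ?C = "balg :: 'c ealg"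
  interpret ealg_target ?A ?B ?C
    by (intro effect_algebra_target effect_algebra_balg)
  have bi: "bimorphism ?A ?B ?C (\<lambda>a b. inf (f a) (g b))"
  proof -
    have m: "inf (inf x c) (inf y c) = inf (inf x y) c" "inf (inf c x) (inf c y) = inf (inf x y) c"
      for x y c :: 'c
      by (simp_all add: inf.commute inf.left_commute inf.assoc)
    have "inf (f a) (f a') = bot" if "inf a a' = bot" for a a'
      using that f unfolding boolean_hom_def by metis
    moreover have "inf (g a) (g a') = bot" if "inf a a' = bot" for a a'
      using that g unfolding boolean_hom_def by metis
    moreover have "f (sup a a') = sup (f a) (f a')" "f top = top" for a a'
      using f by (simp_all add: boolean_hom_def)
    moreover have "g (sup a a') = sup (g a) (g a')" "g top = top" for a a'
      using g by (simp_all add: boolean_hom_def)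
    ultimately show ?thesis
      by (simp add: bimorphism_def biadditive_def balg_def m inf_sup_distrib1 inf_sup_distrib2)
  qed
  show u: "\<exists>!k. k \<in> ealg_hom (tensor balg balg) ?C \<and>
    (\<forall>a b. k (pure balg balg a b) = inf (f a) (g b))"
    using tensor_universal[OF bi] by (simp add: balg_def)
  have "(\<forall>a b. k (pure balg balg a b) = inf (f a) (g b)) \<longleftrightarrow>
      (\<forall>a. k (pure balg balg a top) = f a) \<and> (\<forall>b. k (pure balg balg top b) = g b)"
    if k: "k \<in> ealg_hom (tensor ?A ?B) ?C" for k
  proof
    assume "\<forall>a b. k (pure balg balg a b) = inf (f a) (g b)"
    then show "(\<forall>a. k (pure balg balg a top) = f a) \<and> (\<forall>b. k (pure balg balg top b) = g b)"
      using f g by (simp add: boolean_hom_def)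
  next
    assume 1: "(\<forall>a. k (pure balg balg a top) = f a) \<and> (\<forall>b. k (pure balg balg top b) = g b)"
    have p: "biadditive ?A ?B (tensor ?A ?B) (pure ?A ?B)"
      by (intro biadditive_pure effect_algebra_balg)
    have ka: "k \<in> additive_maps (tensor ?A ?B) ?C" using k by (simp add: ealg_hom_def)
    have r: "inf (k (pure ?A ?B a b)) (k (pure ?A ?B a b')) = bot \<and>
      k (pure ?A ?B a (sup b b')) = sup (k (pure ?A ?B a b)) (k (pure ?A ?B a b'))"
      if "inf b b' = bot" for a b b'
    proof -
      have "osum (tensor ?A ?B) (pure ?A ?B a b) (pure ?A ?B a b') = Some (pure ?A ?B a (sup b b'))"
        "pure ?A ?B a b \<in> ecarrier (tensor ?A ?B)" "pure ?A ?B a b' \<in> ecarrier (tensor ?A ?B)"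
        using p that by (simp_all add: biadditive_def balg_def)
      then have "osum ?C (k (pure ?A ?B a b)) (k (pure ?A ?B a b')) =
          Some (k (pure ?A ?B a (sup b b')))"
        using ka unfolding additive_maps_def by blast
      then show ?thesis by (auto simp: balg_def split: if_splits)
    qed
    have l: "k (pure ?A ?B (sup a a') b) = sup (k (pure ?A ?B a b)) (k (pure ?A ?B a' b))"
      if "inf a a' = bot" for a a' b
    proof -
      have "osum (tensor ?A ?B) (pure ?A ?B a b) (pure ?A ?B a' b) = Some (pure ?A ?B (sup a a') b)"
        "pure ?A ?B a b \<in> ecarrier (tensor ?A ?B)" "pure ?A ?B a' b \<in> ecarrier (tensor ?A ?B)"
        using p that by (simp_all add: biadditive_def balg_def)
      then have "osum ?C (k (pure ?A ?B a b)) (k (pure ?A ?B a' b)) =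
          Some (k (pure ?A ?B (sup a a') b))"
        using ka unfolding additive_maps_def by blast
      then show ?thesis by (auto simp: balg_def split: if_splits)
    qed
    show "\<forall>a b. k (pure balg balg a b) = inf (f a) (g b)"
    proof (intro allI)
      fix a b
      have le: "k (pure ?A ?B a b) \<le> g b" for b
      proof -
        have "k (pure ?A ?B top b) = sup (k (pure ?A ?B a b)) (k (pure ?A ?B (- a) b))"
          using l[of a "- a" b] by simp
        then show ?thesis using 1 by simp
      qed
      have fa: "f a = sup (k (pure ?A ?B a b)) (k (pure ?A ?B a (- b)))"
        using r[of b "- b" a] 1 by simp
      have "inf (k (pure ?A ?B a (- b))) (g b) = bot"
      proof -
        have "k (pure ?A ?B a (- b)) \<le> - g b" using le[of "- b"] g by (simp add: boolean_hom_def)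
        then have "inf (k (pure ?A ?B a (- b))) (g b) \<le> inf (- g b) (g b)" by (rule inf_mono) simp
        then show ?thesis by (simp add: bot_unique)
      qed
      then have "inf (f a) (g b) = inf (k (pure ?A ?B a b)) (g b)"
        using fa by (simp add: inf_sup_distrib2)
      then show "k (pure ?A ?B a b) = inf (f a) (g b)" using le[of b] by (simp add: inf.absorb1)
    qed
  qed
  then have "k \<in> ealg_hom (tensor ?A ?B) ?C \<and>
      (\<forall>a b. k (pure balg balg a b) = inf (f a) (g b)) \<longleftrightarrow>
    k \<in> ealg_hom (tensor ?A ?B) ?C \<and>
      (\<forall>a. k (pure balg balg a top) = f a) \<and> (\<forall>b. k (pure balg balg top b) = g b)" for k
    by blast
  then show "\<exists>!k. k \<in> ealg_hom (tensor balg balg) ?C \<and>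
    (\<forall>a. k (pure balg balg a top) = f a) \<and> (\<forall>b. k (pure balg balg top b) = g b)"
    using u by simp
qed


section \<open>The category BKer\<close>

text \<open>\<open>bker_hom A B\<close> is the set of morphisms from \<open>A\<close> to \<open>B\<close> in BKer.\<close>

definition bker_hom :: "'a ealg \<Rightarrow> 'b ealg \<Rightarrow> ('b \<Rightarrow> (real \<times> 'a) multiset set) set" where
  "bker_hom A B = ealg_hom B (tensor unit_interval A)"

text \<open>Unit \<open>A \<cong> \<two> \<otimes> A \<rightarrow> \<I> \<otimes> A\<close> and multiplication \<open>\<I> \<otimes> (\<I> \<otimes> A) \<cong> (\<I> \<otimes> \<I>) \<otimes> A \<rightarrow> \<I> \<otimes> A\<close>
  of the monad.\<close>

definition monad_unit :: "'a ealg \<Rightarrow> 'a \<Rightarrow> (real \<times> 'a) multiset set" where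
  "monad_unit A = compose (ecarrier A)
     (tensor_map two A unit_interval A interval_unit (\<lambda>a\<in>ecarrier A. a))
     (\<lambda>a\<in>ecarrier A. pure two A True a)"

definition monad_mult ::
  "'a ealg \<Rightarrow> (real \<times> (real \<times> 'a) multiset set) multiset set \<Rightarrow> (real \<times> 'a) multiset set" where
  "monad_mult A = compose (ecarrier (tensor unit_interval (tensor unit_interval A)))
     (tensor_map (tensor unit_interval unit_interval) A unit_interval A interval_mult (\<lambda>a\<in>ecarrier A. a))
     (tensor_assoc unit_interval unit_interval A)"

text \<open>\<open>bker_comp A B C g f\<close> is the composite \<open>g \<circ> f\<close> in BKer of \<open>f : A \<rightarrow> B\<close> and \<open>g : B \<rightarrow> C\<close>,
  i.e. the Kleisli composite \<open>C \<rightarrow> \<I> \<otimes> B \<rightarrow> \<I> \<otimes> (\<I> \<otimes> A) \<rightarrow> \<I> \<otimes> A\<close>.\<close>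

definition bker_comp :: "'a ealg \<Rightarrow> 'b ealg \<Rightarrow> 'c ealg \<Rightarrow>
    ('c \<Rightarrow> (real \<times> 'b) multiset set) \<Rightarrow> ('b \<Rightarrow> (real \<times> 'a) multiset set) \<Rightarrow>
    'c \<Rightarrow> (real \<times> 'a) multiset set" where
  "bker_comp A B C g f = compose (ecarrier C) (monad_mult A)
     (compose (ecarrier C)
        (tensor_map unit_interval B unit_interval (tensor unit_interval A) (\<lambda>r\<in>ecarrier unit_interval. r) f) g)"

text \<open>The tensor of \<open>f : A \<rightarrow> B\<close> and \<open>f' : A' \<rightarrow> B'\<close>, a morphism \<open>A \<otimes> A' \<rightarrow> B \<otimes> B'\<close>.\<close>

definition bker_tensor :: "'a ealg \<Rightarrow> 'b ealg \<Rightarrow> 'c ealg \<Rightarrow> 'd ealg \<Rightarrow>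
    ('b \<Rightarrow> (real \<times> 'a) multiset set) \<Rightarrow> ('d \<Rightarrow> (real \<times> 'c) multiset set) \<Rightarrow>
    ('b \<times> 'd) multiset set \<Rightarrow> (real \<times> ('a \<times> 'c) multiset set) multiset set" where
  "bker_tensor A B A' B' f f' = compose (ecarrier (tensor B B'))
     (tensor_map (tensor unit_interval unit_interval) (tensor A A') unit_interval (tensor A A')
        interval_mult (\<lambda>t\<in>ecarrier (tensor A A'). t))
     (compose (ecarrier (tensor B B'))
        (tensor_interchange unit_interval A unit_interval A')
        (tensor_map B B' (tensor unit_interval A) (tensor unit_interval A') f f'))"

text \<open>\<open>balg_embed A B h\<close> is the morphism \<open>A \<rightarrow> B\<close> of BKer given by \<open>h : B \<rightarrow> A\<close>.\<close>

definition balg_embed ::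
  "'a ealg \<Rightarrow> 'b ealg \<Rightarrow> ('b \<Rightarrow> 'a) \<Rightarrow> 'b \<Rightarrow> (real \<times> 'a) multiset set" where
  "balg_embed A B h = compose (ecarrier B) (monad_unit A) h"

definition bker_copy ::
  "'a ealg \<Rightarrow> ('a \<times> 'a) multiset set \<Rightarrow> (real \<times> 'a) multiset set" where
  "bker_copy A = compose (ecarrier (tensor A A)) (monad_unit A) (codiagonal A)"

definition bker_deterministic ::
  "'a ealg \<Rightarrow> 'b ealg \<Rightarrow> ('b \<Rightarrow> (real \<times> 'a) multiset set) \<Rightarrow> bool" where
  "bker_deterministic A B f \<longleftrightarrow>
     bker_comp A B (tensor B B) (bker_copy B) f =
     bker_comp A (tensor A A) (tensor B B) (bker_tensor A B A B f f) (bker_copy A)"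

end

theory Submission
  imports Defs
begin

text \<open>Think of \<open>\<I> \<otimes> A\<close> as the step functions with values in \<open>[0,1]\<close> on the Stone space of \<open>A\<close>:
  \<open>r \<otimes> a\<close> is \<open>r\<close> times the indicator of \<open>a\<close>. Pointwise multiplication is a biadditive product on
  \<open>\<I> \<otimes> A\<close>, and unfolding the Kleisli structure shows that \<open>f\<close> is deterministic exactly when
  \<open>f (b \<and> b') = f b \<cdot> f b'\<close> (\<open>bker_deterministic_iff\<close>). Maps \<open>b \<mapsto> 1 \<otimes> h b\<close> with \<open>h\<close> a Boolean
  homomorphism clearly satisfy this.

  Conversely, taking \<open>b = b'\<close>, every \<open>f b\<close> is idempotent, hence a step function with values in
  \<open>{0,1}\<close>, hence the indicator \<open>1 \<otimes> h b\<close> of some \<open>h b\<close>. Additivity of \<open>f\<close> makes \<open>h\<close> additive, and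
  additive unital maps between Boolean algebras are Boolean homomorphisms.

  Two facts make the picture of functions rigorous. Every element of \<open>\<I> \<otimes> A\<close> really is constant
  on the members of a finite partition of \<open>A\<close> (\<open>simple_on_top\<close>), so that \<open>{0,1}\<close>-valued elements
  can be recognised piece by piece (\<open>simple_on_sharp\<close>). And there are enough points, i.e.
  homomorphisms from \<open>A\<close> to \<open>\<two>\<close>, to tell the elements of \<open>A\<close> apart (\<open>points_le\<close>); each of them
  induces an evaluation \<open>\<I> \<otimes> A \<rightarrow> [0,1]\<close>.\<close>

section \<open>Maps of effect algebras\<close>

lemma ealg_homD:
  assumes "f \<in> ealg_hom E F"
  shows "f \<in> additive_maps E F"
    and "a \<in> ecarrier E \<Longrightarrow> f a \<in> ecarrier F"
    and "\<lbrakk>a \<in> ecarrier E; b \<in> ecarrier E; osum E a b = Some c\<rbrakk> \<Longrightarrow> osum F (f a) (f b) = Some (f c)"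
    and "f (eone E) = eone F"
  using assms by (auto simp: ealg_hom_def additive_maps_def)

lemma ealg_hom_restrict:
  assumes "effect_algebra E"
    and "\<And>a. a \<in> ecarrier E \<Longrightarrow> f a \<in> ecarrier F"
    and "\<And>a b c. \<lbrakk>a \<in> ecarrier E; b \<in> ecarrier E; osum E a b = Some c\<rbrakk> \<Longrightarrow>
      osum F (f a) (f b) = Some (f c)"
    and "f (eone E) = eone F"
  shows "(\<lambda>a\<in>ecarrier E. f a) \<in> ealg_hom E F"
proof -
  interpret effect_algebra E by fact
  have "osum F ((\<lambda>a\<in>ecarrier E. f a) a) ((\<lambda>a\<in>ecarrier E. f a) b) = Some ((\<lambda>a\<in>ecarrier E. f a) c)"
    if "a \<in> ecarrier E" "b \<in> ecarrier E" "osum E a b = Some c" for a b c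
    using assms(3)[OF that] osum_closed[OF that] that by simp
  then show ?thesis
    using assms(2,4) one_closed by (simp add: ealg_hom_def additive_maps_def)
qed

lemma ealg_hom_id: "effect_algebra E \<Longrightarrow> (\<lambda>a\<in>ecarrier E. a) \<in> ealg_hom E E"
  by (rule ealg_hom_restrict) auto

lemma ealg_hom_compose:
  assumes "effect_algebra E" and f: "f \<in> ealg_hom E F" and g: "g \<in> ealg_hom F G"
  shows "compose (ecarrier E) g f \<in> ealg_hom E G"
  unfolding compose_def
  by (intro ealg_hom_restrict assms(1) ealg_homD(2,3)[OF g] ealg_homD(2,3)[OF f])
    (simp_all add: ealg_homD(4)[OF f] ealg_homD(4)[OF g])

lemma biadditive_compose:
  assumes h: "biadditive E F G h" and k: "k \<in> additive_maps G X"
  shows "biadditive E F X (\<lambda>a b. k (h a b))"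
proof -
  have 1: "\<And>u. u \<in> ecarrier G \<Longrightarrow> k u \<in> ecarrier X"
    and 2: "\<And>u v w. \<lbrakk>u \<in> ecarrier G; v \<in> ecarrier G; osum G u v = Some w\<rbrakk> \<Longrightarrow>
      osum X (k u) (k v) = Some (k w)"
    using k by (auto simp: additive_maps_def)
  show ?thesis
    unfolding biadditive_def
    by (intro conjI ballI allI impI 1 2 biadditiveD[OF h])
qed

lemma biadditive_zero:
  assumes E: "effect_algebra E" and F: "effect_algebra F" and G: "effect_algebra G"
    and h: "biadditive E F G h"
  shows "a \<in> ecarrier E \<Longrightarrow> h a (ezero F) = ezero G"
    and "b \<in> ecarrier F \<Longrightarrow> h (ezero E) b = ezero G"
proof -
  interpret E: effect_algebra E by fact
  interpret F: effect_algebra F by fact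
  interpret G: effect_algebra G by fact
  note z = E.zero_closed F.zero_closed E.osum_zero[OF E.zero_closed] F.osum_zero[OF F.zero_closed]
  show "h a (ezero F) = ezero G" if a: "a \<in> ecarrier E"
    using biadditiveD(3)[OF h z(2) z(2) z(4) a] biadditiveD(1)[OF h a z(2)] by (simp add: G.osum_self_zero)
  show "h (ezero E) b = ezero G" if b: "b \<in> ecarrier F"
    using biadditiveD(2)[OF h z(1) z(1) z(3) b] biadditiveD(1)[OF h z(1) b] by (simp add: G.osum_self_zero)
qed

text \<open>The middle-four law for partial sums. It replaces rearranging by hand wherever two decomposed
  elements are added componentwise.\<close>

lemma (in effect_algebra) osum_exchange:
  assumes "a \<in> ecarrier E" "b \<in> ecarrier E" "c \<in> ecarrier E" "d \<in> ecarrier E"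
    and "osum E a b = Some s" "osum E c d = Some t" "osum E s t = Some w"
  obtains p q where "osum E a c = Some p" "osum E b d = Some q" "osum E p q = Some w"
proof -
  define H where "H = (\<lambda>i::nat. if i = 0 then a else if i = 1 then b else if i = 2 then c else d)"
  have "msum H ({#0, 1#} + {#2, 3#}) = Some w"
    using assms by (subst msum_union) (simp add: H_def padd_def zero_closed osum_zero_right)
  moreover have "{#0, 1#} + {#2, 3#} = {#0, 2#} + {#1, 3::nat#}" by simp
  ultimately have "msum H ({#0, 2#} + {#1, 3#}) = Some w" by metis
  then have "Option.bind (osum E a c) (\<lambda>p. Option.bind (osum E b d) (osum E p)) = Some w"
    using assms by (subst (asm) msum_union) (simp add: H_def padd_def zero_closed osum_zero_right)
  then show ?thesis using that by (auto simp: bind_eq_Some_conv)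
qed

section \<open>Maps out of a tensor product\<close>

text \<open>Pure tensors generate the tensor product under partial sums: its elements are classes of
  formal sums, which can be built up one summand at a time because every part of a summable formal
  sum is summable.\<close>

lemma (in ealg_pair) tensor_induct [consumes 1, case_names zero add]:
  assumes "t \<in> ecarrier (tensor E F)"
    and zero: "P (ezero (tensor E F))"
    and add: "\<And>t a b s. \<lbrakk>t \<in> ecarrier (tensor E F); P t; a \<in> ecarrier E; b \<in> ecarrier F;
      osum (tensor E F) t (pure E F a b) = Some s\<rbrakk> \<Longrightarrow> P s"
  shows "P t"
proof -
  obtain x where x: "x \<in> summable_formal E F" "t = tclass E F x" using assms(1) by (rule tensor_cases)
  have "P (tclass E F x)" using x(1)
  proof (induction x)
    case empty
    show ?case using zero by (simp add: tensor_zero)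
  next
    case (add p x)
    obtain a b where p: "p = (a, b)" by fastforce
    have ab: "a \<in> ecarrier E" "b \<in> ecarrier F" "x \<in> formal_sums E F"
      using add.prems p by (auto simp: summable_formal_def)
    have x: "x \<in> summable_formal E F" using add.prems summable_formal_right[of "{#p#}" x] by simp
    have "osum (tensor E F) (tclass E F x) (pure E F a b) = Some (tclass E F (add_mset p x))"
      using add.prems ab p by (simp add: pure_def tensor_osum)
    then show ?case
      using assms(3)[of "tclass E F x" a b] ab x add.IH by (simp add: tclass_in_tensor)
  qed
  then show ?thesis using x by simp
qed

lemma pure_in_tensor:
  "\<lbrakk>effect_algebra E; effect_algebra F; a \<in> ecarrier E; b \<in> ecarrier F\<rbrakk> \<Longrightarrow>
    pure E F a b \<in> ecarrier (tensor E F)"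
  by (simp add: ealg_pair.pure_closed effect_algebra_pair)

text \<open>Pure tensors also determine a biadditive map on two tensor products: fixing one argument
  reduces this to the uniqueness of additive maps out of a single tensor product.\<close>

lemma biadditive_pure_eqI:
  assumes alg: "effect_algebra E" "effect_algebra F" "effect_algebra E'" "effect_algebra F'"
      "effect_algebra G"
    and h: "biadditive (tensor E F) (tensor E' F') G h"
    and k: "biadditive (tensor E F) (tensor E' F') G k"
    and eq: "\<And>a b c d. \<lbrakk>a \<in> ecarrier E; b \<in> ecarrier F; c \<in> ecarrier E'; d \<in> ecarrier F'\<rbrakk> \<Longrightarrow>
      h (pure E F a b) (pure E' F' c d) = k (pure E F a b) (pure E' F' c d)"
    and s: "s \<in> ecarrier (tensor E F)" and t: "t \<in> ecarrier (tensor E' F')"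
  shows "h s t = k s t"
proof -
  interpret P: ealg_target E F G using alg by (simp add: effect_algebra_target)
  interpret Q: ealg_target E' F' G using alg by (simp add: effect_algebra_target)
  have id: "(\<lambda>x\<in>ecarrier G. x) \<in> additive_maps G G"
    using ealg_hom_id[OF alg(5)] by (simp add: ealg_hom_def)
  have TS: "effect_algebra (tensor E F)" "effect_algebra (tensor E' F')"
    using alg by (simp_all add: effect_algebra_tensorI)
  note sl = biadditive_slices[OF TS(2) _ id]
  have 1: "h (pure E F a b) t = k (pure E F a b) t"
    if ab: "a \<in> ecarrier E" "b \<in> ecarrier F" and t: "t \<in> ecarrier (tensor E' F')" for a b t
  proof -
    note p = P.pure_closed[OF ab]
    have "(\<lambda>t\<in>ecarrier (tensor E' F'). (\<lambda>x\<in>ecarrier G. x) (h (pure E F a b) t)) =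
          (\<lambda>t\<in>ecarrier (tensor E' F'). (\<lambda>x\<in>ecarrier G. x) (k (pure E F a b) t))" (is "?f = ?g")
      by (rule Q.additive_eqI[OF sl(1)[OF h p] sl(1)[OF k p]])
        (simp add: Q.pure_closed eq ab)
    then have "?f t = ?g t" by (rule fun_cong)
    then show ?thesis using t p biadditiveD(1)[OF h p t] biadditiveD(1)[OF k p t] by simp
  qed
  have "(\<lambda>s\<in>ecarrier (tensor E F). (\<lambda>x\<in>ecarrier G. x) (h s t)) =
        (\<lambda>s\<in>ecarrier (tensor E F). (\<lambda>x\<in>ecarrier G. x) (k s t))" (is "?f = ?g")
    by (rule P.additive_eqI[OF sl(2)[OF h TS(1) t] sl(2)[OF k TS(1) t]])
      (simp add: P.pure_closed 1 t)
  then have "?f s = ?g s" by (rule fun_cong)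
  then show ?thesis using s biadditiveD(1)[OF h s t] biadditiveD(1)[OF k s t] by simp
qed

lemma tensor_lift_props:
  assumes "effect_algebra E" "effect_algebra F" "effect_algebra G" "bimorphism E F G h"
  shows tensor_lift_hom: "tensor_lift E F G h \<in> ealg_hom (tensor E F) G"
    and tensor_lift_pure: "\<lbrakk>a \<in> ecarrier E; b \<in> ecarrier F\<rbrakk> \<Longrightarrow>
      tensor_lift E F G h (pure E F a b) = h a b"
  using theI'[OF ealg_target.tensor_universal[OF effect_algebra_target[OF assms(1-3)] assms(4)]]
  by (auto simp: tensor_lift_def)

lemma tensor_map_props:
  assumes alg: "effect_algebra E" "effect_algebra F" "effect_algebra E'" "effect_algebra F'"
    and f: "f \<in> ealg_hom E E'" and g: "g \<in> ealg_hom F F'"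
  shows tensor_map_hom: "tensor_map E F E' F' f g \<in> ealg_hom (tensor E F) (tensor E' F')"
    and tensor_map_pure: "\<lbrakk>a \<in> ecarrier E; b \<in> ecarrier F\<rbrakk> \<Longrightarrow>
      tensor_map E F E' F' f g (pure E F a b) = pure E' F' (f a) (g b)"
proof -
  note p = biadditive_pure[OF alg(3,4)]
  have "biadditive E F (tensor E' F') (\<lambda>a b. pure E' F' (f a) (g b))"
    unfolding biadditive_def
    by (intro conjI ballI allI impI biadditiveD[OF p] ealg_homD(2,3)[OF f] ealg_homD(2,3)[OF g])
  then have b: "bimorphism E F (tensor E' F') (\<lambda>a b. pure E' F' (f a) (g b))"
    using alg by (simp add: bimorphism_def ealg_homD(4)[OF f] ealg_homD(4)[OF g] pure_one)
  have T: "effect_algebra (tensor E' F')" using alg by (simp add: effect_algebra_tensorI)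
  show "tensor_map E F E' F' f g \<in> ealg_hom (tensor E F) (tensor E' F')"
    "\<lbrakk>a \<in> ecarrier E; b \<in> ecarrier F\<rbrakk> \<Longrightarrow>
      tensor_map E F E' F' f g (pure E F a b) = pure E' F' (f a) (g b)"
    using tensor_lift_props[OF alg(1,2) T b] by (simp_all add: tensor_map_def)
qed

lemma tensor_assoc_props:
  assumes "effect_algebra E" "effect_algebra F" "effect_algebra G"
  shows tensor_assoc_hom:
      "tensor_assoc E F G \<in> ealg_hom (tensor E (tensor F G)) (tensor (tensor E F) G)"
    and tensor_assoc_pure: "\<lbrakk>a \<in> ecarrier E; b \<in> ecarrier F; c \<in> ecarrier G\<rbrakk> \<Longrightarrow>
      tensor_assoc E F G (pure E (tensor F G) a (pure F G b c)) = pure (tensor E F) G (pure E F a b) c"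
  using theI'[OF assoc_unique[OF assms]] by (auto simp: tensor_assoc_def)

lemma tensor_interchange_props:
  assumes "effect_algebra E" "effect_algebra F" "effect_algebra G" "effect_algebra H"
  shows tensor_interchange_hom: "tensor_interchange E F G H \<in>
      ealg_hom (tensor (tensor E F) (tensor G H)) (tensor (tensor E G) (tensor F H))"
    and tensor_interchange_pure:
      "\<lbrakk>a \<in> ecarrier E; b \<in> ecarrier F; c \<in> ecarrier G; d \<in> ecarrier H\<rbrakk> \<Longrightarrow>
      tensor_interchange E F G H (pure (tensor E F) (tensor G H) (pure E F a b) (pure G H c d)) =
      pure (tensor E G) (tensor F H) (pure E G a c) (pure F H b d)"
  using theI'[OF interchange_unique[OF assms]] by (auto simp: tensor_interchange_def)

section \<open>Structure maps of the Kleisli category\<close>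

lemma balg_simps [simp]:
  "ecarrier balg = UNIV" "ezero balg = bot" "eone balg = top"
  "osum balg a b = Some c \<longleftrightarrow> inf a b = bot \<and> c = sup a b"
  by (auto simp: balg_def)

lemma unit_interval_simps [simp]:
  "ecarrier unit_interval = {0..1}" "ezero unit_interval = 0" "eone unit_interval = 1"
  "osum unit_interval r s = Some q \<longleftrightarrow> r + s \<le> 1 \<and> q = r + s"
  by (auto simp: unit_interval_def)

lemmas [simp] = effect_algebra_balg effect_algebra_unit_interval effect_algebra_tensorI

lemma interval_mult_props:
  shows interval_mult_hom: "interval_mult \<in> ealg_hom (tensor unit_interval unit_interval) unit_interval"
    and interval_mult_pure: "\<lbrakk>r \<in> {0..1}; s \<in> {0..1}\<rbrakk> \<Longrightarrow>
      interval_mult (pure unit_interval unit_interval r s) = r * s"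
  unfolding interval_mult_def
  using tensor_lift_props[OF _ _ _ bimorphism_mult] by simp_all

lemma interval_unit_hom: "interval_unit \<in> ealg_hom two unit_interval"
  unfolding interval_unit_def
  using theI'[OF two_initial[OF effect_algebra_unit_interval]] .

lemma interval_unit_True: "interval_unit True = 1"
  using ealg_homD(4)[OF interval_unit_hom] by simp

lemma monad_unit_apply:
  assumes A: "effect_algebra A" and a: "a \<in> ecarrier A"
  shows "monad_unit A a = pure unit_interval A 1 a"
  using a tensor_map_pure[OF effect_algebra_balg A effect_algebra_unit_interval A
      interval_unit_hom ealg_hom_id[OF A], of True a]
  by (simp add: monad_unit_def compose_def interval_unit_True)

lemma monad_unit_hom:
  assumes A: "effect_algebra A"
  shows "monad_unit A \<in> ealg_hom A (tensor unit_interval A)"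
proof -
  note p = biadditive_pure[OF effect_algebra_unit_interval A]
  have "(\<lambda>a\<in>ecarrier A. pure unit_interval A 1 a) \<in> ealg_hom A (tensor unit_interval A)"
    using pure_one[OF effect_algebra_unit_interval A] biadditiveD(1,3)[OF p] A
    by (intro ealg_hom_restrict) auto
  moreover have "monad_unit A = (\<lambda>a\<in>ecarrier A. pure unit_interval A 1 a)"
    using monad_unit_apply[OF A] by (auto simp: fun_eq_iff monad_unit_def compose_def)
  ultimately show ?thesis by simp
qed

lemma monad_mult_props:
  assumes A: "effect_algebra A"
  shows monad_mult_hom:
      "monad_mult A \<in> ealg_hom (tensor unit_interval (tensor unit_interval A)) (tensor unit_interval A)"
    and monad_mult_pure: "\<lbrakk>r \<in> {0..1}; s \<in> {0..1}; a \<in> ecarrier A\<rbrakk> \<Longrightarrow>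
      monad_mult A (pure unit_interval (tensor unit_interval A) r (pure unit_interval A s a)) =
      pure unit_interval A (r * s) a"
proof -
  let ?I = unit_interval
  have alg: "effect_algebra ?I" "effect_algebra (tensor ?I ?I)" "effect_algebra (tensor ?I A)"
    "effect_algebra (tensor ?I (tensor ?I A))" using A by simp_all
  note assoc = tensor_assoc_props[OF alg(1) alg(1) A]
  note map = tensor_map_props[OF alg(2) A alg(1) A interval_mult_hom ealg_hom_id[OF A]]
  show "monad_mult A \<in> ealg_hom (tensor ?I (tensor ?I A)) (tensor ?I A)"
    unfolding monad_mult_def using assoc(1) map(1) alg by (intro ealg_hom_compose)
  show "monad_mult A (pure ?I (tensor ?I A) r (pure ?I A s a)) = pure ?I A (r * s) a"
    if "r \<in> {0..1}" "s \<in> {0..1}" "a \<in> ecarrier A"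
    using that assoc(2)[of r s a] map(2)[of "pure ?I ?I r s" a] interval_mult_pure[of r s] alg A
    by (simp add: monad_mult_def compose_def pure_in_tensor)
qed

text \<open>A unit law of the monad. The copy map factors through the unit, so this law reduces
  \<open>copy \<circ> f\<close> to \<open>f\<close> applied after the codiagonal.\<close>

lemma monad_mult_unit:
  assumes A: "effect_algebra A" and t: "t \<in> ecarrier (tensor unit_interval A)"
  shows "monad_mult A (pure unit_interval (tensor unit_interval A) 1 t) = t"
proof -
  let ?T = "tensor unit_interval A"
  have T: "effect_algebra ?T" using A by simp
  interpret ealg_target unit_interval A ?T using A T by (simp add: effect_algebra_target)
  note sl = biadditive_slices(1)[OF T biadditive_pure[OF effect_algebra_unit_interval T]
      ealg_homD(1)[OF monad_mult_hom[OF A]], of 1]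
  have "(\<lambda>t\<in>ecarrier ?T. monad_mult A (pure unit_interval ?T 1 t)) = (\<lambda>t\<in>ecarrier ?T. t)" (is "?f = ?g")
    using sl ealg_homD(1)[OF ealg_hom_id[OF T]] A
    by (intro additive_eqI) (auto simp: monad_mult_pure pure_closed)
  then have "?f t = ?g t" by (rule fun_cong)
  then show ?thesis using t by simp
qed

text \<open>The coproduct property gives one map with value \<open>a \<and> b\<close> on \<open>a \<otimes> b\<close>. It restricts to the
  identity along both coprojections, so it is the codiagonal.\<close>

lemma codiagonal_props:
  fixes a b :: "'a::boolean_algebra"
  shows codiagonal_hom: "codiagonal (balg :: 'a ealg) \<in> ealg_hom (tensor balg balg) balg"
    and codiagonal_pure: "codiagonal balg (pure balg balg a b) = inf a b"
proof -
  let ?A = "balg :: 'a ealg"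
  have id: "boolean_hom (\<lambda>a::'a. a)" by (simp add: boolean_hom_def)
  obtain k where k: "k \<in> ealg_hom (tensor ?A ?A) ?A" "\<And>a b. k (pure ?A ?A a b) = inf a b"
    using tensor_coproduct(2)[OF id id] by auto
  have "codiagonal ?A = k"
    unfolding codiagonal_def
    using tensor_coproduct(1)[OF id id] k
    by (intro the1_equality) (auto simp: all_conj_distrib)
  then show "codiagonal ?A \<in> ealg_hom (tensor ?A ?A) ?A"
    "codiagonal ?A (pure ?A ?A a b) = inf a b" using k by simp_all
qed

lemma bker_copy_props:
  fixes a b :: "'a::boolean_algebra"
  shows bker_copy_hom: "bker_copy (balg :: 'a ealg) \<in> ealg_hom (tensor balg balg) (tensor unit_interval balg)"
    and bker_copy_pure: "bker_copy balg (pure balg balg a b) = pure unit_interval balg 1 (inf a b)"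
  using ealg_hom_compose[OF _ codiagonal_hom monad_unit_hom]
  by (simp_all add: bker_copy_def compose_def codiagonal_pure monad_unit_apply pure_in_tensor)

lemma bker_comp_hom:
  assumes A: "effect_algebra A" and B: "effect_algebra B" and C: "effect_algebra C"
    and f: "f \<in> bker_hom A B" and g: "g \<in> bker_hom B C"
  shows "bker_comp A B C g f \<in> bker_hom A C"
proof -
  note map = tensor_map_hom[OF effect_algebra_unit_interval B effect_algebra_unit_interval _
      ealg_hom_id[OF effect_algebra_unit_interval] f[unfolded bker_hom_def]]
  show ?thesis
    unfolding bker_comp_def bker_hom_def
    using map A B C g monad_mult_hom[OF A] by (intro ealg_hom_compose) (simp_all add: bker_hom_def)
qed

lemma bker_tensor_hom:
  assumes alg: "effect_algebra A" "effect_algebra B" "effect_algebra A'" "effect_algebra B'"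
    and f: "f \<in> bker_hom A B" and f': "f' \<in> bker_hom A' B'"
  shows "bker_tensor A B A' B' f f' \<in> bker_hom (tensor A A') (tensor B B')"
  unfolding bker_tensor_def bker_hom_def
  using alg f f'
  by (intro ealg_hom_compose[OF _ ealg_hom_compose[OF _ tensor_map_hom tensor_interchange_hom]
        tensor_map_hom] ealg_hom_id)
    (simp_all add: bker_hom_def interval_mult_hom)

section \<open>Both sides of the determinism equation\<close>

lemma copy_after_pure:
  fixes f :: "'b::boolean_algebra \<Rightarrow> (real \<times> 'a) multiset set"
  assumes A: "effect_algebra A" and f: "f \<in> bker_hom A (balg :: 'b ealg)"
  shows "bker_comp A balg (tensor balg balg) (bker_copy balg) f (pure balg balg b b') = f (inf b b')"
proof -
  let ?B = "balg :: 'b ealg" and ?I = unit_interval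
  have T: "effect_algebra (tensor ?I A)" using A by simp
  have f': "f \<in> ealg_hom ?B (tensor ?I A)" using f by (simp add: bker_hom_def)
  have "pure ?B ?B b b' \<in> ecarrier (tensor ?B ?B)"
    by (simp add: pure_in_tensor)
  then show ?thesis
    using A T tensor_map_pure[OF _ _ _ T ealg_hom_id f', of ?I 1 "inf b b'"]
      monad_mult_unit[OF A ealg_homD(2)[OF f']]
    by (simp add: bker_comp_def compose_def bker_copy_pure)
qed

text \<open>Pointwise multiplication of step functions. The definition is the composite that
  \<open>(f \<otimes> f) \<circ> copy\<close> applies to \<open>f b \<otimes> f b'\<close>: interchange, multiplication of scalars,
  copying of \<open>A\<close>, and multiplication of the monad. Being a composite of morphisms, it needs no
  separate proof of well-definedness; the value \<open>rs \<otimes> (a \<and> b)\<close> on pure tensors is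
  \<open>interval_tensor_mult_pure\<close>.\<close>

definition interval_tensor_mult ::
  "(real \<times> 'a::boolean_algebra) multiset set \<Rightarrow> (real \<times> 'a) multiset set \<Rightarrow> (real \<times> 'a) multiset set"
where
  "interval_tensor_mult t u = monad_mult balg
     (tensor_map unit_interval (tensor balg balg) unit_interval (tensor unit_interval balg)
        (\<lambda>r\<in>ecarrier unit_interval. r) (bker_copy balg)
     (tensor_map (tensor unit_interval unit_interval) (tensor balg balg) unit_interval (tensor balg balg)
        interval_mult (\<lambda>t\<in>ecarrier (tensor balg balg). t)
     (tensor_interchange unit_interval balg unit_interval balg
        (pure (tensor unit_interval balg) (tensor unit_interval balg) t u))))"

lemma after_copy_pure:
  fixes f :: "'b::boolean_algebra \<Rightarrow> (real \<times> 'a::boolean_algebra) multiset set"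
  assumes f: "f \<in> bker_hom (balg :: 'a ealg) (balg :: 'b ealg)"
  shows "bker_comp balg (tensor balg balg) (tensor balg balg)
      (bker_tensor balg balg balg balg f f) (bker_copy balg) (pure balg balg b b') =
    interval_tensor_mult (f b) (f b')"
proof -
  let ?B = "balg :: 'b ealg"
  have T: "effect_algebra (tensor unit_interval (balg :: 'a ealg))" by simp
  have f': "f \<in> ealg_hom ?B (tensor unit_interval balg)" using f by (simp add: bker_hom_def)
  have "pure ?B ?B b b' \<in> ecarrier (tensor ?B ?B)"
    by (simp add: pure_in_tensor)
  then show ?thesis
    using tensor_map_pure[OF _ _ T T f' f', of b b']
    by (simp add: bker_comp_def bker_tensor_def compose_def interval_tensor_mult_def)
qed

lemma interval_tensor_mult_pure:
  fixes a b :: "'a::boolean_algebra"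
  assumes r: "r \<in> {0..1}" and s: "s \<in> {0..1}"
  shows "interval_tensor_mult (pure unit_interval balg r a) (pure unit_interval balg s b) =
    pure unit_interval balg (r * s) (inf a b)"
proof -
  let ?I = unit_interval and ?A = "balg :: 'a ealg"
  have p: "pure ?A ?A a b \<in> ecarrier (tensor ?A ?A)" "pure ?I ?I r s \<in> ecarrier (tensor ?I ?I)"
    using r s by (simp_all add: pure_in_tensor)
  have rs: "r * s \<in> {0..1}" using r s by (auto simp: mult_le_one)
  have 1: "tensor_interchange ?I ?A ?I ?A
      (pure (tensor ?I ?A) (tensor ?I ?A) (pure ?I ?A r a) (pure ?I ?A s b)) =
      pure (tensor ?I ?I) (tensor ?A ?A) (pure ?I ?I r s) (pure ?A ?A a b)"
    using r s by (intro tensor_interchange_pure) auto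
  have 2: "tensor_map (tensor ?I ?I) (tensor ?A ?A) ?I (tensor ?A ?A)
        interval_mult (\<lambda>t\<in>ecarrier (tensor ?A ?A). t)
        (pure (tensor ?I ?I) (tensor ?A ?A) (pure ?I ?I r s) (pure ?A ?A a b)) =
      pure ?I (tensor ?A ?A) (r * s) (pure ?A ?A a b)"
    using p interval_mult_pure[OF r s] by (subst tensor_map_pure) (auto simp: interval_mult_hom ealg_hom_id)
  have 3: "tensor_map ?I (tensor ?A ?A) ?I (tensor ?I ?A) (\<lambda>r\<in>ecarrier ?I. r) (bker_copy ?A)
        (pure ?I (tensor ?A ?A) (r * s) (pure ?A ?A a b)) =
      pure ?I (tensor ?I ?A) (r * s) (pure ?I ?A 1 (inf a b))"
    using p rs tensor_map_pure[OF _ _ _ _ ealg_hom_id bker_copy_hom, of ?I "r * s" "pure ?A ?A a b"]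
    by (simp add: bker_copy_pure)
  have "monad_mult ?A (pure ?I (tensor ?I ?A) (r * s) (pure ?I ?A 1 (inf a b))) = pure ?I ?A (r * s) (inf a b)"
    using monad_mult_pure[of ?A "r * s" 1 "inf a b"] rs by simp
  then show ?thesis by (simp only: interval_tensor_mult_def 1 2 3)
qed

lemma biadditive_interval_tensor_mult:
  "biadditive (tensor unit_interval balg) (tensor unit_interval balg) (tensor unit_interval balg)
     (interval_tensor_mult :: (real \<times> 'a::boolean_algebra) multiset set \<Rightarrow> _)"
proof -
  let ?I = unit_interval and ?A = "balg :: 'a ealg"
  have T: "effect_algebra (tensor ?I ?A)" by simp
  note 1 = biadditive_compose[OF biadditive_pure[OF T T] ealg_homD(1)[OF
      tensor_interchange_hom[of ?I ?A ?I ?A]]]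
  note 2 = biadditive_compose[OF 1 ealg_homD(1)[OF tensor_map_hom[OF _ _ _ _ interval_mult_hom ealg_hom_id]]]
  note 3 = biadditive_compose[OF 2 ealg_homD(1)[OF tensor_map_hom[OF _ _ _ _ ealg_hom_id bker_copy_hom]]]
  note 4 = biadditive_compose[OF 3 ealg_homD(1)[OF monad_mult_hom]]
  show ?thesis unfolding interval_tensor_mult_def[abs_def] by (rule 4) simp_all
qed

lemma bker_deterministic_iff:
  fixes f :: "'b::boolean_algebra \<Rightarrow> (real \<times> 'a::boolean_algebra) multiset set"
  assumes f: "f \<in> bker_hom (balg :: 'a ealg) (balg :: 'b ealg)"
  shows "bker_deterministic (balg :: 'a ealg) (balg :: 'b ealg) f \<longleftrightarrow>
    (\<forall>b b'. f (inf b b') = interval_tensor_mult (f b) (f b'))"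
proof
  assume "bker_deterministic (balg :: 'a ealg) (balg :: 'b ealg) f"
  then show "\<forall>b b'. f (inf b b') = interval_tensor_mult (f b) (f b')"
    using copy_after_pure[OF effect_algebra_balg f] after_copy_pure[OF f]
    unfolding bker_deterministic_def by metis
next
  assume m: "\<forall>b b'. f (inf b b') = interval_tensor_mult (f b) (f b')"
  let ?A = "balg :: 'a ealg" and ?B = "balg :: 'b ealg"
  interpret ealg_target ?B ?B "tensor unit_interval ?A" by (intro effect_algebra_target) simp_all
  have copy: "bker_copy ?A \<in> bker_hom ?A (tensor ?A ?A)" "bker_copy ?B \<in> bker_hom ?B (tensor ?B ?B)"
    using bker_copy_hom by (auto simp: bker_hom_def)
  show "bker_deterministic ?A ?B f"
    unfolding bker_deterministic_def
  proof (rule additive_eqI)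
    show "bker_comp ?A ?B (tensor ?B ?B) (bker_copy ?B) f \<in>
        additive_maps (tensor ?B ?B) (tensor unit_interval ?A)"
      using bker_comp_hom[OF _ _ _ f copy(2)] by (simp add: bker_hom_def ealg_homD(1))
    show "bker_comp ?A (tensor ?A ?A) (tensor ?B ?B) (bker_tensor ?A ?B ?A ?B f f) (bker_copy ?A) \<in>
        additive_maps (tensor ?B ?B) (tensor unit_interval ?A)"
      using bker_comp_hom[OF _ _ _ copy(1) bker_tensor_hom[OF _ _ _ _ f f]]
      by (simp add: bker_hom_def ealg_homD(1))
  qed (use m in \<open>simp add: copy_after_pure[OF effect_algebra_balg f] after_copy_pure[OF f]\<close>)
qed

section \<open>Points of a Boolean algebra\<close>

text \<open>The Boolean prime ideal theorem: by Zorn's lemma the principal filter of \<open>a\<close> extends to a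
  maximal proper filter, and membership in such a filter is a homomorphism.\<close>

lemma point_exists:
  fixes a :: "'a::boolean_algebra"
  assumes "a \<noteq> bot"
  obtains \<phi> :: "'a \<Rightarrow> bool" where "boolean_hom \<phi>" "\<phi> a"
proof -
  define proper_filter where "proper_filter F \<longleftrightarrow> a \<in> F \<and> bot \<notin> F \<and>
    (\<forall>x\<in>F. \<forall>y\<in>F. inf x y \<in> F) \<and> (\<forall>x\<in>F. \<forall>y. x \<le> y \<longrightarrow> y \<in> F)" for F :: "'a set"
  have "\<exists>M\<in>Collect proper_filter. \<forall>X\<in>Collect proper_filter. M \<subseteq> X \<longrightarrow> X = M"
  proof (rule subset_Zorn_nonempty)
    have "proper_filter {x. a \<le> x}" using assms by (auto simp: proper_filter_def bot_unique)
    then show "Collect proper_filter \<noteq> {}" by blast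
  next
    fix \<C> assume ne: "\<C> \<noteq> {}" and ch: "subset.chain (Collect proper_filter) \<C>"
    have pf: "proper_filter F" if "F \<in> \<C>" for F using ch that by (auto simp: subset.chain_def)
    have "inf x y \<in> \<Union>\<C>" if x: "x \<in> F" "F \<in> \<C>" and y: "y \<in> G" "G \<in> \<C>" for x y F G
    proof -
      have "F \<subseteq> G \<or> G \<subseteq> F" using ch x y by (auto simp: subset.chain_def)
      then obtain H where "H \<in> \<C>" "x \<in> H" "y \<in> H" using x y by blast
      then show ?thesis using pf by (auto simp: proper_filter_def)
    qed
    then have "\<forall>x\<in>\<Union>\<C>. \<forall>y\<in>\<Union>\<C>. inf x y \<in> \<Union>\<C>" by blast
    moreover have "a \<in> \<Union>\<C>" "bot \<notin> \<Union>\<C>"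
      using ne pf unfolding proper_filter_def by blast+
    moreover have "y \<in> \<Union>\<C>" if "x \<in> \<Union>\<C>" "x \<le> y" for x y
      using that pf unfolding proper_filter_def by blast
    ultimately show "\<Union>\<C> \<in> Collect proper_filter"
      unfolding proper_filter_def by blast
  qed
  then obtain M where M: "proper_filter M" and max: "\<And>X. proper_filter X \<Longrightarrow> M \<subseteq> X \<Longrightarrow> X = M" by blast
  have up: "y \<in> M" if "x \<in> M" "x \<le> y" for x y using M that by (auto simp: proper_filter_def)
  have meet: "inf x y \<in> M" if "x \<in> M" "y \<in> M" for x y using M that by (auto simp: proper_filter_def)
  have nb: "bot \<notin> M" and a: "a \<in> M" using M by (auto simp: proper_filter_def)
  have inf_iff: "inf x y \<in> M \<longleftrightarrow> x \<in> M \<and> y \<in> M" for x y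
    using up[of "inf x y" x] up[of "inf x y" y] meet by auto
  have compl: "- x \<in> M \<longleftrightarrow> x \<notin> M" for x
  proof
    show "x \<notin> M" if "- x \<in> M" using meet[OF that, of x] nb by auto
    show "- x \<in> M" if x: "x \<notin> M"
    proof (rule ccontr)
      assume nx: "- x \<notin> M"
      \<comment> \<open>The filter generated by \<open>M\<close> and \<open>x\<close> is proper, since no member of \<open>M\<close> is below \<open>- x\<close>.\<close>
      let ?X = "{z. \<exists>y\<in>M. inf y x \<le> z}"
      have "\<not> inf y x \<le> bot" if "y \<in> M" for y
        using up[OF that, of "- x"] nx by (auto simp: bot_unique inf_shunt)
      moreover have "inf z z' \<in> ?X" if z: "z \<in> ?X" "z' \<in> ?X" for z z'
      proof -
        obtain y y' where "y \<in> M" "y' \<in> M" "inf y x \<le> z" "inf y' x \<le> z'" using z by blast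
        moreover from this have "inf (inf y y') x \<le> inf z z'"
          using inf_mono[of "inf y x" z "inf y' x" z'] by (simp add: ac_simps)
        ultimately show ?thesis using meet by blast
      qed
      moreover have "z' \<in> ?X" if "z \<in> ?X" "z \<le> z'" for z z' using that order.trans by blast
      moreover have "a \<in> ?X" using a by (auto intro: le_infI1)
      ultimately have "proper_filter ?X" unfolding proper_filter_def by blast
      moreover have "M \<subseteq> ?X" by (auto intro: le_infI1)
      ultimately have "?X = M" by (rule max)
      moreover have "x \<in> ?X" using a by auto
      ultimately show False using x by blast
    qed
  qed
  have "sup x y \<in> M \<longleftrightarrow> x \<in> M \<or> y \<in> M" for x y
    using compl[of "inf (- x) (- y)"] inf_iff[of "- x" "- y"] compl[of x] compl[of y] by simp
  then have "boolean_hom (\<lambda>x. x \<in> M)"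
    using inf_iff compl nb up[OF a, of top] by (simp add: boolean_hom_def)
  then show ?thesis using that a by blast
qed

lemma points_le:
  fixes a b :: "'a::boolean_algebra"
  assumes "\<And>\<phi> :: 'a \<Rightarrow> bool. \<lbrakk>boolean_hom \<phi>; \<phi> a\<rbrakk> \<Longrightarrow> \<phi> b"
  shows "a \<le> b"
proof (rule ccontr)
  assume "\<not> a \<le> b"
  then have "inf a (- b) \<noteq> bot" by (simp add: inf_shunt)
  then obtain \<phi> :: "'a \<Rightarrow> bool" where "boolean_hom \<phi>" "\<phi> (inf a (- b))" by (rule point_exists)
  then show False using assms[of \<phi>] by (simp add: boolean_hom_def)
qed

section \<open>Elements of the tensor product as simple functions\<close>

abbreviation interval_tensor :: "(real \<times> 'a::boolean_algebra) multiset set ealg" where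
  "interval_tensor \<equiv> tensor unit_interval balg"

abbreviation scaled :: "real \<Rightarrow> 'a::boolean_algebra \<Rightarrow> (real \<times> 'a) multiset set" where
  "scaled \<equiv> pure unit_interval balg"

lemma scaled_closed: "r \<in> {0..1} \<Longrightarrow> scaled r a \<in> ecarrier interval_tensor"
  by (simp add: pure_in_tensor)

lemma scaled_add_scalar:
  "\<lbrakk>0 \<le> r; 0 \<le> s; r + s \<le> 1\<rbrakk> \<Longrightarrow> osum interval_tensor (scaled r a) (scaled s a) = Some (scaled (r + s) a)"
  by (rule biadditiveD(2)[OF biadditive_pure]) simp_all

lemma scaled_sup:
  "\<lbrakk>r \<in> {0..1}; inf a b = bot\<rbrakk> \<Longrightarrow> osum interval_tensor (scaled r a) (scaled r b) = Some (scaled r (sup a b))"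
  by (rule biadditiveD(3)[OF biadditive_pure]) simp_all

lemma scaled_bot: "r \<in> {0..1} \<Longrightarrow> scaled r bot = ezero interval_tensor"
  and scaled_zero: "scaled 0 a = ezero interval_tensor"
  using biadditive_zero[OF _ _ _ biadditive_pure, of unit_interval balg] by simp_all

definition eval_at :: "('a::boolean_algebra \<Rightarrow> bool) \<Rightarrow> (real \<times> 'a) multiset set \<Rightarrow> real" where
  "eval_at \<phi> = tensor_lift unit_interval balg unit_interval (\<lambda>r a. r * of_bool (\<phi> a))"

text \<open>A homomorphism \<open>\<phi>\<close> turns disjoint joins into exclusive alternatives, so \<open>r \<cdot> [\<phi> a]\<close> is
  additive in \<open>a\<close> as well as in \<open>r\<close>.\<close>

lemma eval_at_props:
  fixes \<phi> :: "'a::boolean_algebra \<Rightarrow> bool"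
  assumes "boolean_hom \<phi>"
  shows eval_at_hom: "eval_at \<phi> \<in> ealg_hom interval_tensor unit_interval"
    and eval_at_scaled: "r \<in> {0..1} \<Longrightarrow> eval_at \<phi> (scaled r a) = r * of_bool (\<phi> a)"
proof -
  have sup: "\<phi> (sup a b) = (\<phi> a \<or> \<phi> b)" and disj: "inf a b = bot \<Longrightarrow> \<not> (\<phi> a \<and> \<phi> b)" for a b
    using assms unfolding boolean_hom_def by (simp, metis inf_bool_def bot_bool_def)
  have b: "bimorphism unit_interval balg unit_interval (\<lambda>r a. r * of_bool (\<phi> a))"
    using assms disj by (auto simp: bimorphism_def biadditive_def sup of_bool_def boolean_hom_def)
  show "eval_at \<phi> \<in> ealg_hom interval_tensor unit_interval"
    "r \<in> {0..1} \<Longrightarrow> eval_at \<phi> (scaled r a) = r * of_bool (\<phi> a)"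
    unfolding eval_at_def using tensor_lift_props[OF _ _ _ b] by simp_all
qed

lemma eval_at_osum:
  assumes "boolean_hom \<phi>" "t \<in> ecarrier interval_tensor" "u \<in> ecarrier interval_tensor"
    and "osum interval_tensor t u = Some v"
  shows "eval_at \<phi> v = eval_at \<phi> t + eval_at \<phi> u" "eval_at \<phi> t + eval_at \<phi> u \<le> 1"
  using ealg_homD(3)[OF eval_at_hom assms(2-4)] assms(1) by simp_all

lemma eval_at_mult:
  assumes \<phi>: "boolean_hom \<phi>"
    and t: "t \<in> ecarrier interval_tensor" and u: "u \<in> ecarrier interval_tensor"
  shows "eval_at \<phi> (interval_tensor_mult t u) = eval_at \<phi> t * eval_at \<phi> u"
proof (rule biadditive_pure_eqI[OF _ _ _ _ _ _ _ _ t u])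
  note e = eval_at_hom[OF \<phi>]
  show "biadditive interval_tensor interval_tensor unit_interval
      (\<lambda>t u. eval_at \<phi> (interval_tensor_mult t u))"
    by (rule biadditive_compose[OF biadditive_interval_tensor_mult ealg_homD(1)[OF e]])
  have "biadditive unit_interval unit_interval unit_interval (\<lambda>r s::real. r * s)"
    using bimorphism_mult by (simp add: bimorphism_def)
  note m = biadditiveD[OF this]
  show "biadditive interval_tensor interval_tensor unit_interval (\<lambda>t u. eval_at \<phi> t * eval_at \<phi> u)"
    unfolding biadditive_def by (intro conjI ballI allI impI m ealg_homD(2,3)[OF e])
  have "\<phi> (inf a b) = (\<phi> a \<and> \<phi> b)" for a b using \<phi> by (simp add: boolean_hom_def)
  then show "eval_at \<phi> (interval_tensor_mult (scaled r a) (scaled s b)) =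
      eval_at \<phi> (scaled r a) * eval_at \<phi> (scaled s b)"
    if "r \<in> ecarrier unit_interval" "s \<in> ecarrier unit_interval" for r s a b
    using that by (simp add: interval_tensor_mult_pure eval_at_scaled[OF \<phi>] mult_le_one)
qed simp_all

text \<open>\<open>simple_on c t\<close>: the step function \<open>t\<close> vanishes off \<open>c\<close> and is constant on each member of some
  finite partition of \<open>c\<close>. Building the partition up by disjoint gluing, instead of listing its
  members, turns refinements of partitions into rule inductions.\<close>

inductive simple_on :: "'a::boolean_algebra \<Rightarrow> (real \<times> 'a) multiset set \<Rightarrow> bool" where
  const: "r \<in> {0..1} \<Longrightarrow> simple_on c (scaled r c)"
| glue: "\<lbrakk>simple_on c t; simple_on d u; inf c d = bot; osum interval_tensor t u = Some v\<rbrakk>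
    \<Longrightarrow> simple_on (sup c d) v"

lemma interval_tensor_alg: "effect_algebra interval_tensor"
  by simp

lemmas interval_tensor_closed = effect_algebra.osum_closed[OF interval_tensor_alg]
lemmas interval_tensor_exchange = effect_algebra.osum_exchange[OF interval_tensor_alg]

lemma simple_on_closed: "simple_on c t \<Longrightarrow> t \<in> ecarrier interval_tensor"
  by (induction rule: simple_on.induct) (auto intro: scaled_closed interval_tensor_closed)

lemma simple_on_split:
  assumes "simple_on c t"
  shows "\<exists>u v. simple_on (inf c a) u \<and> simple_on (inf c (- a)) v \<and> osum interval_tensor u v = Some t"
  using assms
proof (induction rule: simple_on.induct)
  case (const r c)
  have "inf (inf c a) (inf c (- a)) = bot" by (simp add: inf.assoc inf.left_commute)
  moreover have "sup (inf c a) (inf c (- a)) = c" by (simp flip: inf_sup_distrib1)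
  ultimately show ?case using const scaled_sup[of r "inf c a" "inf c (- a)"] simple_on.const by metis
next
  case (glue c t d u v)
  obtain t1 t2 where t: "simple_on (inf c a) t1" "simple_on (inf c (- a)) t2"
    "osum interval_tensor t1 t2 = Some t" using glue.IH by blast
  obtain u1 u2 where u: "simple_on (inf d a) u1" "simple_on (inf d (- a)) u2"
    "osum interval_tensor u1 u2 = Some u" using glue.IH by blast
  note cl = t(1,2)[THEN simple_on_closed] u(1,2)[THEN simple_on_closed]
  obtain p q where pq: "osum interval_tensor t1 u1 = Some p" "osum interval_tensor t2 u2 = Some q"
    "osum interval_tensor p q = Some v"
    using interval_tensor_exchange[OF cl t(3) u(3) glue.hyps(4)] by blast
  have "inf (inf c x) (inf d x) = bot" for x
    using glue.hyps(3) by (metis inf.assoc inf.commute inf_bot_left)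
  then show ?case
    using simple_on.glue[OF t(1) u(1) _ pq(1)] simple_on.glue[OF t(2) u(2) _ pq(2)] pq(3)
    by (auto simp: inf_sup_distrib2)
qed

text \<open>Adding a constant raises the value on each piece. The sum \<open>r' \<otimes> c \<oplus> r \<otimes> c\<close> can be defined
  with \<open>r' + r > 1\<close> only if \<open>c = 0\<close>, since evaluating it at a point of \<open>c\<close> would give a value
  above 1.\<close>

lemma simple_on_add:
  assumes "simple_on c t" "r \<in> {0..1}" "osum interval_tensor t (scaled r c) = Some s"
  shows "simple_on c s"
  using assms
proof (induction arbitrary: s rule: simple_on.induct)
  case (const r' c)
  show ?case
  proof (cases "r' + r \<le> 1")
    case True
    then show ?thesis using const scaled_add_scalar[of r' r c] simple_on.const[of "r' + r" c] by simp
  next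
    case False
    have "c = bot"
    proof (rule ccontr)
      assume "c \<noteq> bot"
      then obtain \<phi> where \<phi>: "boolean_hom \<phi>" "\<phi> c" by (rule point_exists)
      show False
        using eval_at_osum(2)[OF \<phi>(1) scaled_closed scaled_closed const(3)] const(1,2) False \<phi>
        by (simp add: eval_at_scaled)
    qed
    then have "s = scaled r c"
      using const by (simp add: scaled_bot effect_algebra.osum_zero[OF interval_tensor_alg]
          effect_algebra.zero_closed[OF interval_tensor_alg])
    then show ?thesis using simple_on.const[OF const(2)] by simp
  qed
next
  case (glue c t d u v)
  note cl = glue.hyps(1,2)[THEN simple_on_closed] scaled_closed[OF glue.prems(1), of c]
    scaled_closed[OF glue.prems(1), of d]
  obtain p q where "osum interval_tensor t (scaled r c) = Some p"
    "osum interval_tensor u (scaled r d) = Some q" "osum interval_tensor p q = Some s"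
    using interval_tensor_exchange[OF cl glue.hyps(4) scaled_sup[OF glue.prems(1) glue.hyps(3)] glue.prems(2)]
    by blast
  then show ?case using glue simple_on.glue by blast
qed

text \<open>To add a further summand \<open>r \<otimes> a\<close> to a step function, cut the latter along \<open>a\<close> and \<open>- a\<close>; then
  only the part on \<open>a\<close> changes, by the constant \<open>r\<close>.\<close>

lemma simple_on_top:
  fixes t :: "(real \<times> 'a::boolean_algebra) multiset set"
  assumes "t \<in> ecarrier interval_tensor"
  shows "simple_on top t"
proof -
  interpret ealg_pair unit_interval "balg :: 'a ealg" by (simp add: effect_algebra_pair)
  interpret T: effect_algebra "interval_tensor :: (real \<times> 'a) multiset set ealg" by simp
  show ?thesis using assms
  proof (induction rule: tensor_induct)
    case zero
    show ?case using simple_on.const[of 0 top] by (simp add: scaled_zero)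
  next
    case (add t r a s)
    obtain u v where uv: "simple_on a u" "simple_on (- a) v" "osum interval_tensor u v = Some t"
      using simple_on_split[OF add.IH, of a] by auto
    note cl = uv(1,2)[THEN simple_on_closed] pure_closed[OF add.hyps(2,3)]
    obtain p q where pq: "osum interval_tensor u (scaled r a) = Some p"
      "osum interval_tensor v (ezero interval_tensor) = Some q" "osum interval_tensor p q = Some s"
      using interval_tensor_exchange[OF cl T.zero_closed uv(3) T.osum_zero_right[OF cl(3)] add.hyps(4)]
      by blast
    have "q = v" using pq(2) T.osum_zero_right[OF cl(2)] by simp
    moreover have "simple_on a p" using simple_on_add[OF uv(1) _ pq(1)] add.hyps(2) by simp
    ultimately show ?case using simple_on.glue[OF _ uv(2) _ , of a p s] pq(3) by simp
  qed
qed

lemma eval_at_outside: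
  assumes "simple_on c t" "boolean_hom \<phi>" "\<not> \<phi> c"
  shows "eval_at \<phi> t = 0"
  using assms
proof (induction rule: simple_on.induct)
  case (const r c)
  then show ?case by (simp add: eval_at_scaled)
next
  case (glue c t d u v)
  then have "\<not> \<phi> c" "\<not> \<phi> d" by (auto simp: boolean_hom_def)
  then show ?case
    using eval_at_osum(1)[OF glue.prems(1) simple_on_closed simple_on_closed, OF glue.hyps(1,2,4)]
      glue.IH glue.prems(1) by simp
qed

text \<open>On a nonzero piece the constant is one of the values, hence 0 or 1, and the pieces with value
  1 join up to the required element. Values on \<open>c\<close> and on \<open>d\<close> do not interfere when these are
  disjoint, because no point lies in both; so the hypothesis passes from a gluing to its parts.\<close>

lemma simple_on_sharp:
  fixes t :: "(real \<times> 'a::boolean_algebra) multiset set"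
  assumes "simple_on c t" "\<And>\<phi>. boolean_hom \<phi> \<Longrightarrow> eval_at \<phi> t \<in> {0, 1}"
  shows "\<exists>a\<le>c. t = scaled 1 a"
  using assms
proof (induction rule: simple_on.induct)
  case (const r c)
  show ?case
  proof (cases "c = bot \<or> r = 0")
    case True
    then have "scaled r c = scaled 1 bot" using const(1) by (auto simp: scaled_bot scaled_zero)
    then show ?thesis using bot_least by blast
  next
    case False
    then obtain \<phi> where "boolean_hom \<phi>" "\<phi> c" using point_exists by blast
    then have "r = 1" using const(2)[of \<phi>] const(1) False by (simp add: eval_at_scaled)
    then show ?thesis by blast
  qed
next
  case (glue c t d u v)
  have 1: "eval_at \<phi> t \<in> {0, 1} \<and> eval_at \<phi> u \<in> {0, 1}" if \<phi>: "boolean_hom \<phi>" for \<phi>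
  proof -
    have "\<not> (\<phi> c \<and> \<phi> d)" using \<phi> glue.hyps(3) unfolding boolean_hom_def by (metis inf_bool_def bot_bool_def)
    moreover have "eval_at \<phi> v = eval_at \<phi> t + eval_at \<phi> u"
      using eval_at_osum(1)[OF \<phi> _ _ glue.hyps(4)] glue.hyps(1,2) simple_on_closed by blast
    ultimately show ?thesis
      using eval_at_outside[OF glue.hyps(1) \<phi>] eval_at_outside[OF glue.hyps(2) \<phi>] glue.prems[OF \<phi>] by auto
  qed
  obtain a b where ab: "a \<le> c" "t = scaled 1 a" "b \<le> d" "u = scaled 1 b"
    using glue.IH 1 by blast
  have "inf a b = bot" using inf_mono[OF ab(1,3)] glue.hyps(3) by (simp add: bot_unique)
  then have "v = scaled 1 (sup a b)" using scaled_sup[of 1 a b] glue.hyps(4) ab by simp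
  then show ?case using sup_mono[OF ab(1,3)] by blast
qed

section \<open>Deterministic morphisms\<close>

lemma balg_embed_apply: "balg_embed balg balg h b = scaled 1 (h b)"
  by (simp add: balg_embed_def compose_def monad_unit_apply)

theorem lemma11:
  fixes f :: "'b::boolean_algebra \<Rightarrow> (real \<times> 'a::boolean_algebra) multiset set"
  assumes "f \<in> bker_hom (balg :: 'a ealg) (balg :: 'b ealg)"
  shows "bker_deterministic (balg :: 'a ealg) (balg :: 'b ealg) f \<longleftrightarrow>
    f \<in> balg_embed (balg :: 'a ealg) (balg :: 'b ealg) ` {h. boolean_hom h}"
proof
  assume "f \<in> balg_embed (balg :: 'a ealg) (balg :: 'b ealg) ` {h. boolean_hom h}"
  then obtain h where "boolean_hom h" "\<And>b. f b = scaled 1 (h b)" by (auto simp: balg_embed_apply)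
  then show "bker_deterministic (balg :: 'a ealg) (balg :: 'b ealg) f"
    by (simp add: bker_deterministic_iff[OF assms] interval_tensor_mult_pure boolean_hom_def)
next
  assume det: "bker_deterministic (balg :: 'a ealg) (balg :: 'b ealg) f"
  have f: "f \<in> ealg_hom balg interval_tensor" using assms by (simp add: bker_hom_def)
  have cl: "f b \<in> ecarrier interval_tensor" for b using ealg_homD(2)[OF f, of b] by simp
  \<comment> \<open>A real number equal to its own square is 0 or 1.\<close>
  have "\<exists>a. f b = scaled 1 a" for b
  proof -
    have "eval_at \<phi> (f b) \<in> {0, 1}" if "boolean_hom \<phi>" for \<phi>
    proof -
      have "f b = interval_tensor_mult (f b) (f b)"
        using det bker_deterministic_iff[OF assms] by (metis inf.idem)
      then have "eval_at \<phi> (f b) = eval_at \<phi> (f b) * eval_at \<phi> (f b)"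
        using eval_at_mult[OF that cl cl] by metis
      then show ?thesis by simp
    qed
    then show ?thesis using simple_on_sharp[OF simple_on_top[OF cl]] by blast
  qed
  then obtain h where h: "\<And>b. f b = scaled 1 (h b)" by metis
  have ev: "eval_at \<phi> (f b) = of_bool (\<phi> (h b))" if "boolean_hom \<phi>" for \<phi> b
    using that by (simp add: h eval_at_scaled)
  have "\<phi> (h top)" if "boolean_hom \<phi>" for \<phi>
    using ev[OF that, of top] ealg_homD(4)[OF f] ealg_homD(4)[OF eval_at_hom[OF that]] by (auto split: if_splits)
  then have top: "h top = top" by (intro top_le points_le) blast
  \<comment> \<open>Additivity of \<open>f\<close> is only visible through \<open>1 \<otimes> h b\<close>. Evaluating at points transfers it to
    \<open>h\<close>: at each point \<open>[h b] + [h b'] = [h (b \<or> b')] \<le> 1\<close>, and points separate elements.\<close>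
  have sum: "inf (h b) (h b') = bot \<and> h (sup b b') = sup (h b) (h b')" if "inf b b' = bot" for b b'
  proof -
    have "\<not> (\<phi> (h b) \<and> \<phi> (h b')) \<and> (\<phi> (h (sup b b')) \<longleftrightarrow> \<phi> (h b) \<or> \<phi> (h b'))"
      if \<phi>: "boolean_hom \<phi>" for \<phi>
    proof -
      have "osum interval_tensor (f b) (f b') = Some (f (sup b b'))"
        using ealg_homD(3)[OF f, of b b' "sup b b'"] \<open>inf b b' = bot\<close> by simp
      then show ?thesis using eval_at_osum[OF \<phi> cl cl, of b b'] ev[OF \<phi>] by (auto simp: of_bool_def split: if_splits)
    qed
    then show ?thesis
      by (intro conjI order.antisym points_le bot_least) (auto simp: boolean_hom_def)
  qed
  have "h \<in> ealg_hom balg balg"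
    using top sum by (simp add: ealg_hom_def additive_maps_def)
  then have "boolean_hom h" by (simp add: boolean_hom_iff)
  moreover have "f = balg_embed balg balg h" by (simp add: fun_eq_iff balg_embed_apply h)
  ultimately show "f \<in> balg_embed (balg :: 'a ealg) (balg :: 'b ealg) ` {h. boolean_hom h}" by blast
qed

end
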